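(* Let $m>0$, $|a|<m$, $S<0$, $R,\widetilde R\in\mathbb R$, $X=S(\widetilde r-\widetilde R)$, and let $\widetilde{\mathbf g}$ be the transformed metric in the outgoing case. In the outgoing coordinates $(\widetilde u,\widetilde r,\widetilde\theta,\widetilde\varphi_-)$ the following hold. 1. In the region $X\le-2$, where $\widetilde{\mathbf g}$ is Lorentzian, the metric components are smooth and $\widetilde{\mathbf g}$ has a smooth past event horizon $\widetilde{\mathcal H}^-=\{X=-2\}$ (parametrized by $(\widetilde u,\widetilde\theta,\widetilde\varphi_-)$). Moreover $\widetilde{\mathbf g}$ is asymptotically flat and has a complete smooth future null infinity $\widetilde{\mathcal I}^+=\{X=-\infty\}$ (parametrized by $(\widetilde u,\widetilde\theta,\widetilde\varphi_-)$). 2. In the region $X>X_+(\widetilde\theta)=\frac{2|a\cos\widetilde\theta|}{m-|a\cos\widetilde\theta|}$, where $\widetilde{\mathbf g}$ is Lorentzian, $\widetilde{\mathbf g}$ is asymptotically flat and has a complete smooth future null infinity $\widetilde{\mathcal I}^+=\{X=+\infty\}$ (parametrized by $(\widetilde u,\widetilde\theta,\widetilde\varphi_-)$).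
   Context: **Transformed metric.** $\Delta(r)=r^2-2mr+a^2$. In coordinates $(\widetilde v,\widetilde r,\widetilde\theta,\widetilde\varphi)$, $|\widetilde q|^2\widetilde{\mathbf g}^{-1}=\widetilde{\mathbf h}+O$ with non-vanishing components $\widetilde{\mathbf h}^{\widetilde r\widetilde r}=S^{-2}X(X+2)$, $\widetilde{\mathbf h}^{\widetilde v\widetilde r}=S^{-1}((R-m)X^2+2RX)$, $\widetilde{\mathbf h}^{\widetilde v\widetilde v}=\Delta(R)X^2+2(R^2+a^2)X$, $\widetilde{\mathbf h}^{\widetilde v\widetilde\varphi}=aX$ (and symmetric ones), and $O=\partial_{\widetilde\theta}\otimes\partial_{\widetilde\theta}+\frac1{\sin^2\widetilde\theta}(a\sin^2\widetilde\theta\,\partial_{\widetilde v}+\partial_{\widetilde\varphi})^{\otimes2}$. The conformal factor is $|\widetilde q|^2=\frac{|X|}{|S|}\sqrt{|P(X,\widetilde\theta)|}$, $P(X,\widetilde\theta)=-(m^2-a^2\cos^2\widetilde\theta)X^2+4a^2\cos^2\widetilde\theta\,X+4a^2\cos^2\widetilde\theta$. **Outgoing coordinates.** First $\widetilde t=\widetilde v-\widetilde r^*(\widetilde r)$ with $\frac{d\widetilde r^*}{d\widetilde r}=\frac{(R-m)X+2R}{\widetilde r-\widetilde R+2/S}$. Then $$\widetilde u=\widetilde t\mp\int\frac{\sqrt{(m^2-a^2)X^2-4a^2X-4a^2}}{|\widetilde r-\widetilde R+2/S|}\,d\widetilde r,\qquad \widetilde\varphi_-=\widetilde\varphi\mp\int\frac{a}{\sqrt{m^2-a^2}}\,\frac{d\widetilde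 r}{\widetilde r-\widetilde R},$$ with the upper sign for $\widetilde r>\widetilde R-\frac2S$ (i.e. $X<-2$) and the lower sign for $\widetilde r<\widetilde R$ (i.e. $X>0$, where the square root is real, in particular for $X$ large). **Meaning of the asymptotic statements.** Asymptotic flatness with a smooth future null infinity is meant in the sense of conformal compactification: with $\widetilde\rho=|X+1|^{-1}$, the metric $\widetilde\rho^{\,2}\,\widetilde{\mathbf g}$ in coordinates $(\widetilde u,\widetilde\rho,\widetilde\theta,\widetilde\varphi_-)$ extends smoothly, as a Lorentzian metric, to $\widetilde\rho=0$, and $\{\widetilde\rho=0\}$ is a null hypersurface; completeness refers to $\widetilde u$ ranging over all of $\mathbb R$. The past event horizon $\{X=-2\}$ is a null hypersurface across which the metric components in these coordinates are smooth. *)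

theory Defs
  imports "HOL-Analysis.Analysis"
begin

text \<open>
  Points of a coordinate chart are vectors of \<open>real^4\<close>, with coordinates ordered as
  \<open>(v, r, \<theta>, \<phi>)\<close> for the given coordinates, \<open>(u, r, \<theta>, \<phi>\<^sub>-)\<close> for the outgoing ones and
  \<open>(u, \<rho>, \<theta>, \<phi>\<^sub>-)\<close> for the compactified ones. The polar angle ranges over \<open>0 < \<theta> < \<pi>\<close>; the
  azimuthal angle is a real number, the period \<open>2\<pi>\<close> being left implicit.
  A metric is given by its matrix of components.
\<close>

type_synonym metric_field = "real^4 \<Rightarrow> real^4^4"

section \<open>Lorentzian metrics, smoothness, null hypersurfaces\<close>

definition minkowski :: "real^4^4" where
  "minkowski = (\<chi> i j. if i = j then (if i = 1 then - 1 else 1) else 0)"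

definition lorentzian :: "real^4^4 \<Rightarrow> bool" where
  "lorentzian A \<longleftrightarrow> transpose A = A \<and>
     (\<exists>E. invertible E \<and> transpose E ** A ** E = minkowski)"

primrec C_times_on ::
  "nat \<Rightarrow> 'a::real_normed_vector set \<Rightarrow> ('a \<Rightarrow> 'b::real_normed_vector) \<Rightarrow> bool" where
  "C_times_on 0 U f \<longleftrightarrow> continuous_on U f"
| "C_times_on (Suc n) U f \<longleftrightarrow> (\<forall>x\<in>U. f differentiable (at x)) \<and>
     (\<forall>w. C_times_on n U (\<lambda>x. frechet_derivative f (at x) w))"

text \<open>Meant for open \<open>U\<close> only, since the derivatives are taken at full neighbourhoods.\<close>

definition smooth_on_open ::
  "'a::real_normed_vector set \<Rightarrow> ('a \<Rightarrow> 'b::real_normed_vector) \<Rightarrow> bool" where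
  "smooth_on_open U f \<longleftrightarrow> (\<forall>n. C_times_on n U f)"

definition pullback :: "(real^4 \<Rightarrow> real^4) \<Rightarrow> metric_field \<Rightarrow> metric_field" where
  "pullback \<Psi> G x =
     transpose (jacobian \<Psi> (at x)) ** G (\<Psi> x) ** jacobian \<Psi> (at x)"

text \<open>
  The hypersurface on which the second coordinate is constant has tangent space
  \<open>{W. W $ 2 = 0}\<close>; it is null at \<open>p\<close> if the metric induced on this space is degenerate.
\<close>

definition null_level_at :: "metric_field \<Rightarrow> real^4 \<Rightarrow> bool" where
  "null_level_at G p \<longleftrightarrow>
     (\<exists>N. N \<noteq> 0 \<and> N $ 2 = 0 \<and> (\<forall>W. W $ 2 = 0 \<longrightarrow> N \<bullet> (G p *v W) = 0))"

section \<open>The transformed metric\<close>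

definition X_fun :: "real \<Rightarrow> real \<Rightarrow> real \<Rightarrow> real" where
  "X_fun S Rt r = S * (r - Rt)"

definition Delta :: "real \<Rightarrow> real \<Rightarrow> real \<Rightarrow> real" where
  "Delta m a r = r^2 - 2 * m * r + a^2"

definition P_fun :: "real \<Rightarrow> real \<Rightarrow> real \<Rightarrow> real \<Rightarrow> real" where
  "P_fun m a X \<theta> = - (m^2 - a^2 * (cos \<theta>)^2) * X^2
     + 4 * a^2 * (cos \<theta>)^2 * X + 4 * a^2 * (cos \<theta>)^2"

definition qt_sq :: "real \<Rightarrow> real \<Rightarrow> real \<Rightarrow> real \<Rightarrow> real^4 \<Rightarrow> real" where
  "qt_sq m a S Rt x = (let X = X_fun S Rt (x $ 2) in
     \<bar>X\<bar> / \<bar>S\<bar> * sqrt \<bar>P_fun m a X (x $ 3)\<bar>)"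

definition h_inv :: "real \<Rightarrow> real \<Rightarrow> real \<Rightarrow> real \<Rightarrow> real \<Rightarrow> metric_field" where
  "h_inv m a S R Rt x = (let X = X_fun S Rt (x $ 2);
      hrr = X * (X + 2) / S^2;
      hvr = ((R - m) * X^2 + 2 * R * X) / S;
      hvv = Delta m a R * X^2 + 2 * (R^2 + a^2) * X;
      hvp = a * X
    in vector [vector [hvv, hvr, 0, hvp],
               vector [hvr, hrr, 0, 0],
               vector [0,   0,   0, 0],
               vector [hvp, 0,   0, 0]])"

definition tensor_square :: "real^4 \<Rightarrow> real^4^4" where
  "tensor_square w = (\<chi> i j. w $ i * w $ j)"

definition O_inv :: "real \<Rightarrow> metric_field" where
  "O_inv a x = tensor_square (axis 3 1)
     + (1 / (sin (x $ 3))^2) *\<^sub>R tensor_square ((a * (sin (x $ 3))^2) *\<^sub>R axis 1 1 + axis 4 1)"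

definition gt :: "real \<Rightarrow> real \<Rightarrow> real \<Rightarrow> real \<Rightarrow> real \<Rightarrow> metric_field" where
  "gt m a S R Rt x =
     matrix_inv ((1 / qt_sq m a S Rt x) *\<^sub>R (h_inv m a S R Rt x + O_inv a x))"

definition X_plus :: "real \<Rightarrow> real \<Rightarrow> real \<Rightarrow> real" where
  "X_plus m a \<theta> = 2 * \<bar>a * cos \<theta>\<bar> / (m - \<bar>a * cos \<theta>\<bar>)"

section \<open>Outgoing coordinates\<close>

definition Q_fun :: "real \<Rightarrow> real \<Rightarrow> real \<Rightarrow> real" where
  "Q_fun m a X = (m^2 - a^2) * X^2 - 4 * a^2 * X - 4 * a^2"

text \<open>
  \<open>rs\<close>, \<open>w\<close> and \<open>k\<close> are arbitrary choices of the indefinite integrals which define the outgoing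
  coordinates, for \<open>r\<close> in the set \<open>I\<close>.
\<close>

definition outgoing_integrals ::
  "real \<Rightarrow> real \<Rightarrow> real \<Rightarrow> real \<Rightarrow> real \<Rightarrow> real set \<Rightarrow>
   (real \<Rightarrow> real) \<Rightarrow> (real \<Rightarrow> real) \<Rightarrow> (real \<Rightarrow> real) \<Rightarrow> bool" where
  "outgoing_integrals m a S R Rt I rs w k \<longleftrightarrow> (\<forall>r\<in>I.
     (rs has_real_derivative ((R - m) * X_fun S Rt r + 2 * R) / (r - Rt + 2 / S)) (at r) \<and>
     (w has_real_derivative sqrt (Q_fun m a (X_fun S Rt r)) / \<bar>r - Rt + 2 / S\<bar>) (at r) \<and>
     (k has_real_derivative a / sqrt (m^2 - a^2) * (1 / (r - Rt))) (at r))"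

text \<open>
  The sign \<open>s\<close> is \<open>1\<close> for \<open>X < -2\<close> and \<open>-1\<close> for \<open>X > 0\<close>. The first component is
  \<open>u = t - s w(r)\<close> with \<open>t = v - rs(r)\<close>.
\<close>

definition outgoing_chart ::
  "real \<Rightarrow> (real \<Rightarrow> real) \<Rightarrow> (real \<Rightarrow> real) \<Rightarrow> (real \<Rightarrow> real) \<Rightarrow> real^4 \<Rightarrow> real^4" where
  "outgoing_chart s rs w k x =
     vector [x $ 1 - rs (x $ 2) - s * w (x $ 2), x $ 2, x $ 3, x $ 4 - s * k (x $ 2)]"

definition compactified_chart ::
  "real \<Rightarrow> real \<Rightarrow> real \<Rightarrow> (real \<Rightarrow> real) \<Rightarrow> (real \<Rightarrow> real) \<Rightarrow> (real \<Rightarrow> real) \<Rightarrow> real^4 \<Rightarrow> real^4" where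
  "compactified_chart S Rt s rs w k x = (let y = outgoing_chart s rs w k x in
     vector [y $ 1, 1 / \<bar>X_fun S Rt (y $ 2) + 1\<bar>, y $ 3, y $ 4])"

definition region_minus :: "real \<Rightarrow> real \<Rightarrow> (real^4) set" where
  "region_minus S Rt = {x. X_fun S Rt (x $ 2) < - 2 \<and> 0 < x $ 3 \<and> x $ 3 < pi}"

text \<open>
  The part of the region \<open>X > X_plus \<theta>\<close> on which the outgoing coordinates are defined
  and smooth: there the square root has to be real and nonzero.
\<close>

definition region_plus :: "real \<Rightarrow> real \<Rightarrow> real \<Rightarrow> real \<Rightarrow> (real^4) set" where
  "region_plus m a S Rt = {x. X_plus m a (x $ 3) < X_fun S Rt (x $ 2) \<and>
     0 < Q_fun m a (X_fun S Rt (x $ 2)) \<and> 0 < x $ 3 \<and> x $ 3 < pi}"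

section \<open>Horizon and null infinity\<close>

text \<open>All real values of the first coordinate are included, which expresses completeness.\<close>

definition level_set :: "real \<Rightarrow> (real^4) set" where
  "level_set c = {p. p $ 2 = c \<and> 0 < p $ 3 \<and> p $ 3 < pi}"

text \<open>
  \<open>\<Psi>\<close> is a chart on the region \<open>M\<close> whose image contains all points with \<open>p $ 2\<close> slightly above
  \<open>c\<close>; in this chart the components of \<open>\<omega> g\<close> agree with those of \<open>G\<close>, which is a smooth
  Lorentzian metric up to and across the null hypersurface \<open>p $ 2 = c\<close>. The stationary field
  \<open>\<partial>\<^sub>u\<close> is timelike on \<open>M\<close>.
\<close>

definition smooth_null_boundary ::
  "metric_field \<Rightarrow> (real^4 \<Rightarrow> real) \<Rightarrow> (real^4) set \<Rightarrow> (real^4 \<Rightarrow> real^4) \<Rightarrow> real \<Rightarrow>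
   (real^4) set \<Rightarrow> metric_field \<Rightarrow> bool" where
  "smooth_null_boundary g \<omega> M \<Psi> c U G \<longleftrightarrow>
     inj_on \<Psi> M \<and>
     (\<exists>\<epsilon>>0. {p. c < p $ 2 \<and> p $ 2 < c + \<epsilon> \<and> 0 < p $ 3 \<and> p $ 3 < pi} \<subseteq> \<Psi> ` M) \<and>
     open U \<and> \<Psi> ` M \<union> level_set c \<subseteq> U \<and>
     smooth_on_open U G \<and> (\<forall>p\<in>U. lorentzian (G p)) \<and>
     (\<forall>x\<in>M. \<Psi> differentiable (at x) \<and> \<omega> x *\<^sub>R g x = pullback \<Psi> G x) \<and>
     (\<forall>p\<in>\<Psi> ` M. G p $ 1 $ 1 < 0) \<and>
     (\<forall>p\<in>level_set c. null_level_at G p)"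

text \<open>
  Time orientation: \<open>\<partial>\<^sub>u\<close> is future-directed. It is timelike in the interior and may become null
  on the boundary, where the inequality still singles out one of the two cones.
\<close>

definition future_timelike :: "metric_field \<Rightarrow> real^4 \<Rightarrow> real^4 \<Rightarrow> bool" where
  "future_timelike G p W \<longleftrightarrow> W \<bullet> (G p *v W) < 0 \<and> axis 1 1 \<bullet> (G p *v W) < 0"

text \<open>
  The region \<open>M\<close> lies on the side \<open>p $ 2 > c\<close>, so a past boundary is one where future-directed
  timelike vectors enter \<open>M\<close>, and a future boundary one where they leave it.
\<close>

definition smooth_past_horizon ::
  "metric_field \<Rightarrow> (real^4) set \<Rightarrow> (real^4 \<Rightarrow> real^4) \<Rightarrow> real \<Rightarrow> bool" where
  "smooth_past_horizon g M \<Psi> c \<longleftrightarrow>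
     (\<exists>U G. smooth_null_boundary g (\<lambda>x. 1) M \<Psi> c U G \<and>
        (\<forall>p\<in>level_set c. \<forall>W. future_timelike G p W \<longrightarrow> 0 < W $ 2))"

text \<open>
  The second component of the chart \<open>\<Psi>\<close> is the boundary defining function \<open>\<rho>\<close>, and
  \<open>\<rho>\<^sup>2 g\<close> is the conformally compactified metric.
\<close>

definition asymptotically_flat_future_null_infinity ::
  "metric_field \<Rightarrow> (real^4) set \<Rightarrow> (real^4 \<Rightarrow> real^4) \<Rightarrow> bool" where
  "asymptotically_flat_future_null_infinity g M \<Psi> \<longleftrightarrow>
     (\<exists>U G. smooth_null_boundary g (\<lambda>x. (\<Psi> x $ 2)^2) M \<Psi> 0 U G \<and>
        (\<forall>p\<in>level_set 0. \<forall>W. future_timelike G p W \<longrightarrow> W $ 2 < 0))"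

end

theory Submission
  imports Defs
begin

text \<open>
  In every chart the inverse metric, up to the conformal factor, is a matrix coupling \<open>\<theta>\<close> to
  nothing else. Its block in the other three coordinates transforms by congruence, and if it has
  negative determinant and positive \<open>\<phi>\<phi>\<close> entry, the metric is Lorentzian. In outgoing
  coordinates the determinant is \<open>X\<^sup>2 P / (S\<^sup>2 sin\<^sup>2 \<theta>)\<close>, so everything reduces to \<open>P < 0\<close>, and all
  entries are smooth across \<open>X = -2\<close>. For null infinity put \<open>X = -1 - \<sigma> / \<rho>\<close> with
  \<open>\<sigma> = 1\<close> for \<open>X < -2\<close> and \<open>\<sigma> = -1\<close> for \<open>X > 0\<close>: the entries of the inverse metric and
  \<open>\<rho>\<^sup>2 |q|\<^sup>2\<close> are then smooth for \<open>\<bar>\<rho>\<bar> < 1\<close> as long as \<open>\<rho>\<^sup>2 Q\<close> and \<open>- \<rho>\<^sup>2 P\<close>, which extend as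
  polynomials, stay positive. On each boundary the \<open>rr\<close> and \<open>r\<phi>\<close> entries of the inverse metric vanish,
  so that \<open>\<partial>\<^sub>u\<close> is the null normal, and the sign of the \<open>ur\<close> entry decides between past and
  future.
\<close>

section \<open>Smooth functions\<close>

text \<open>Functions equal on an open set are equal near each of its points, hence have the same
  Frechet derivatives there, and the induction passes to these.\<close>

lemma C_times_on_cong:
  assumes "open U" "\<And>x. x \<in> U \<Longrightarrow> f x = g x" "C_times_on n U f"
  shows "C_times_on n U g"
  using assms(2,3)
proof (induction n arbitrary: f g)
  case 0
  then show ?case
    using continuous_on_cong[of U U f g] by simp
next
  case (Suc n)
  have eq: "frechet_derivative f (at x) = frechet_derivative g (at x)" if "x \<in> U" for x
    using Suc.prems that assms(1) by (intro frechet_derivative_transform_within_open) auto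
  have "g differentiable (at x)" if "x \<in> U" for x
  proof -
    have "(f has_derivative frechet_derivative f (at x)) (at x)"
      using Suc.prems(2) that frechet_derivative_works by auto
    then have "(g has_derivative frechet_derivative f (at x)) (at x)"
      using assms(1) that Suc.prems(1) by (rule has_derivative_transform_within_open)
    then show ?thesis
      by (rule Derivative.differentiableI)
  qed
  moreover have "C_times_on n U (\<lambda>x. frechet_derivative g (at x) w)" for w
  proof -
    have "C_times_on n U (\<lambda>x. frechet_derivative f (at x) w)"
      using Suc.prems(2) by simp
    then show ?thesis
      by (rule Suc.IH[rotated]) (simp add: eq)
  qed
  ultimately show ?case
    by simp
qed

text \<open>Uniqueness of the derivative lets a computed \<open>f'\<close> replace the choice made
  by \<open>frechet_derivative\<close>. The inductive closure rules below go through this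
  rule.\<close>

lemma C_times_on_SucI:
  assumes "open U" "\<And>x. x \<in> U \<Longrightarrow> (f has_derivative f' x) (at x)"
    and "\<And>w. C_times_on n U (\<lambda>x. f' x w)"
  shows "C_times_on (Suc n) U f"
proof -
  have "f' x = frechet_derivative f (at x)" if "x \<in> U" for x
    using frechet_derivative_at[OF assms(2)[OF that]] .
  then have "C_times_on n U (\<lambda>x. frechet_derivative f (at x) w)" for w
    by (intro C_times_on_cong[OF assms(1) _ assms(3)[of w]]) metis
  moreover have "f differentiable (at x)" if "x \<in> U" for x
    using assms(2)[OF that] by (rule Derivative.differentiableI)
  ultimately show ?thesis
    by simp
qed

lemma C_times_on_Suc_has_derivative:
  assumes "C_times_on (Suc n) U f" "x \<in> U"
  shows "(f has_derivative frechet_derivative f (at x)) (at x)"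
  using assms frechet_derivative_works by auto

lemma C_times_on_SucD: "C_times_on (Suc n) U f \<Longrightarrow> C_times_on n U f"
proof (induction n arbitrary: f)
  case 0
  then show ?case
    by (auto intro!: continuous_at_imp_continuous_on differentiable_imp_continuous_within)
qed auto

lemma C_times_on_const: "open U \<Longrightarrow> C_times_on n U (\<lambda>x. c)"
proof (induction n arbitrary: c)
  case (Suc n)
  then show ?case
    by (intro C_times_on_SucI[where f' = "\<lambda>x w. 0"]) auto
qed auto

lemma C_times_on_bounded_linear:
  assumes "open U" "bounded_linear f"
  shows "C_times_on n U f"
proof (cases n)
  case 0
  then show ?thesis
    using assms(2) by (simp add: linear_continuous_on)
next
  case (Suc k)
  show ?thesis
    unfolding Suc
    by (rule C_times_on_SucI[OF assms(1) bounded_linear_imp_has_derivative[OF assms(2)]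
          C_times_on_const[OF assms(1)]])
qed

lemma C_times_on_add:
  assumes "open U" "C_times_on n U f" "C_times_on n U g"
  shows "C_times_on n U (\<lambda>x. f x + g x)"
  using assms(2,3)
proof (induction n arbitrary: f g)
  case (Suc n)
  have "((\<lambda>x. f x + g x) has_derivative
      (\<lambda>w. frechet_derivative f (at x) w + frechet_derivative g (at x) w)) (at x)" if "x \<in> U" for x
    using Suc.prems that by (intro has_derivative_add C_times_on_Suc_has_derivative)
  then show ?case
    by (rule C_times_on_SucI[OF assms(1)]) (use Suc in auto)
qed (auto intro: continuous_on_add)

text \<open>The Leibniz rule keeps one factor undifferentiated, so the induction also lowers the
  order of \<open>f\<close> and \<open>g\<close> themselves by
  \<open>C_times_on_SucD\<close>.\<close>

lemma C_times_on_mult: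
  fixes f g :: "'a::real_normed_vector \<Rightarrow> real"
  assumes "open U" "C_times_on n U f" "C_times_on n U g"
  shows "C_times_on n U (\<lambda>x. f x * g x)"
  using assms(2,3)
proof (induction n arbitrary: f g)
  case (Suc n)
  have "((\<lambda>x. f x * g x) has_derivative
      (\<lambda>w. f x * frechet_derivative g (at x) w + frechet_derivative f (at x) w * g x)) (at x)"
    if "x \<in> U" for x
    using Suc.prems that by (intro has_derivative_mult C_times_on_Suc_has_derivative)
  then show ?case
    by (rule C_times_on_SucI[OF assms(1)])
      (use Suc C_times_on_SucD[OF Suc.prems(1)] C_times_on_SucD[OF Suc.prems(2)] assms(1)
        in \<open>auto intro!: C_times_on_add\<close>)
qed (auto intro: continuous_on_mult)

lemma C_times_on_uminus:
  fixes f :: "'a::real_normed_vector \<Rightarrow> real"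
  assumes "open U" "C_times_on n U f"
  shows "C_times_on n U (\<lambda>x. - f x)"
  using C_times_on_mult[OF assms(1) C_times_on_const[OF assms(1), of n "- 1"] assms(2)] by simp

text \<open>The derivative of \<open>inverse f\<close> is a product of \<open>inverse f\<close> and
  derivatives of \<open>f\<close>, so the induction hypothesis for \<open>inverse f\<close> at the
  lower order suffices.\<close>

lemma C_times_on_inverse:
  fixes f :: "'a::real_normed_vector \<Rightarrow> real"
  assumes "open U" "C_times_on n U f" "\<And>x. x \<in> U \<Longrightarrow> f x \<noteq> 0"
  shows "C_times_on n U (\<lambda>x. inverse (f x))"
  using assms(2,3)
proof (induction n arbitrary: f)
  case (Suc n)
  have "((\<lambda>x. inverse (f x)) has_derivative
      (\<lambda>w. - (inverse (f x) * frechet_derivative f (at x) w * inverse (f x)))) (at x)"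
    if "x \<in> U" for x
    using Suc.prems that by (intro Deriv.has_derivative_inverse C_times_on_Suc_has_derivative)
  then show ?case
    by (rule C_times_on_SucI[OF assms(1)])
      (use Suc C_times_on_SucD[OF Suc.prems(1)] assms(1)
        in \<open>auto intro!: C_times_on_uminus C_times_on_mult\<close>)
qed (auto intro: continuous_on_inverse)

lemma C_times_on_sqrt:
  fixes f :: "'a::real_normed_vector \<Rightarrow> real"
  assumes "open U" "C_times_on n U f" "\<And>x. x \<in> U \<Longrightarrow> 0 < f x"
  shows "C_times_on n U (\<lambda>x. sqrt (f x))"
  using assms(2,3)
proof (induction n arbitrary: f)
  case (Suc n)
  have d: "((\<lambda>x. sqrt (f x)) has_derivative
      (\<lambda>w. frechet_derivative f (at x) w * (inverse (sqrt (f x)) * (1 / 2)))) (at x)"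
    if "x \<in> U" for x
    using has_derivative_real_sqrt[OF Suc.prems(2)[OF that]
        C_times_on_Suc_has_derivative[OF Suc.prems(1) that]] by simp
  have "C_times_on n U (\<lambda>x. inverse (sqrt (f x)))"
    by (rule C_times_on_inverse[OF assms(1) Suc.IH[OF C_times_on_SucD[OF Suc.prems(1)]]])
      (use Suc.prems in force)+
  then show ?case
    using Suc.prems(1) assms(1)
    by (intro C_times_on_SucI[OF assms(1) d] C_times_on_mult C_times_on_const) auto
qed (auto intro: continuous_on_real_sqrt)

text \<open>Sine and cosine share one induction because each is needed for the derivative of the
  other.\<close>

lemma C_times_on_sin_cos:
  fixes f :: "'a::real_normed_vector \<Rightarrow> real"
  assumes "open U" "C_times_on n U f"
  shows "C_times_on n U (\<lambda>x. sin (f x)) \<and> C_times_on n U (\<lambda>x. cos (f x))"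
  using assms(2)
proof (induction n arbitrary: f)
  case (Suc n)
  have s: "((\<lambda>x. sin (f x)) has_derivative
      (\<lambda>w. frechet_derivative f (at x) w * cos (f x))) (at x)"
   and c: "((\<lambda>x. cos (f x)) has_derivative
      (\<lambda>w. frechet_derivative f (at x) w * - sin (f x))) (at x)"
    if "x \<in> U" for x
    using has_derivative_sin[OF C_times_on_Suc_has_derivative[OF Suc.prems that]]
     has_derivative_cos[OF C_times_on_Suc_has_derivative[OF Suc.prems that]] by (simp_all add: mult_ac)
  show ?case
    by (intro conjI C_times_on_SucI[OF assms(1) s] C_times_on_SucI[OF assms(1) c])
      (use assms(1) Suc.prems Suc.IH[OF C_times_on_SucD[OF Suc.prems]]
        in \<open>auto intro!: C_times_on_mult C_times_on_uminus\<close>)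
qed (auto intro: continuous_on_sin continuous_on_cos)

text \<open>Convergence of the difference quotients can be checked in each component, and linear
  maps on a Euclidean space are bounded.\<close>

lemma has_derivative_vec_lambda:
  fixes f :: "'a::euclidean_space \<Rightarrow> 'b::euclidean_space^'n"
  assumes "\<And>i. ((\<lambda>x. f x $ i) has_derivative f' i) (at x)"
  shows "(f has_derivative (\<lambda>w. \<chi> i. f' i w)) (at x)"
  unfolding has_derivative_at_within
proof (intro conjI vec_tendstoI)
  have "linear (f' i)" for i
    using assms has_derivative_linear by blast
  then have "linear (\<lambda>w. \<chi> i. f' i w)"
    by (auto simp: linear_iff vec_eq_iff)
  then show "bounded_linear (\<lambda>w. \<chi> i. f' i w)"
    using linear_conv_bounded_linear by blast
  show "((\<lambda>y. ((f y - f x - (\<chi> i. f' i (y - x))) /\<^sub>R norm (y - x)) $ i) \<longlongrightarrow> 0 $ i) (at x)" for i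
    using assms[of i] by (simp add: has_derivative_at_within)
qed

text \<open>Applied once to rows and once to entries, this reduces smoothness of a metric to that of
  its components.\<close>

lemma C_times_on_vec_lambda:
  fixes f :: "'a::euclidean_space \<Rightarrow> 'b::euclidean_space^'n"
  assumes "open U" "\<And>i. C_times_on n U (\<lambda>x. f x $ i)"
  shows "C_times_on n U f"
  using assms(2)
proof (induction n arbitrary: f)
  case 0
  then show ?case
    using continuous_on_vec_lambda[of U "\<lambda>i x. f x $ i"] by simp
next
  case (Suc n)
  have "(f has_derivative (\<lambda>w. \<chi> i. frechet_derivative (\<lambda>x. f x $ i) (at x) w)) (at x)" if "x \<in> U" for x
    using Suc.prems that by (intro has_derivative_vec_lambda C_times_on_Suc_has_derivative)
  then show ?case
    by (rule C_times_on_SucI[OF assms(1)]) (use Suc in auto)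
qed

section \<open>Closure rules for smooth functions\<close>

named_theorems smooth_intros

lemma smooth_on_open_const [smooth_intros]: "open U \<Longrightarrow> smooth_on_open U (\<lambda>x. c)"
  by (simp add: smooth_on_open_def C_times_on_const)

lemma smooth_on_open_nth [smooth_intros]:
  "open U \<Longrightarrow> smooth_on_open U (\<lambda>x::real^'n. x $ i)"
  by (simp add: smooth_on_open_def C_times_on_bounded_linear bounded_linear_vec_nth)

lemma smooth_on_open_add [smooth_intros]:
  "open U \<Longrightarrow> smooth_on_open U f \<Longrightarrow> smooth_on_open U g \<Longrightarrow> smooth_on_open U (\<lambda>x. f x + g x)"
  by (simp add: smooth_on_open_def C_times_on_add)

context
  fixes U :: "'a::real_normed_vector set" and f g :: "'a \<Rightarrow> real"
  assumes U: "open U" and f: "smooth_on_open U f"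
begin

lemma smooth_on_open_mult [smooth_intros]:
  "smooth_on_open U g \<Longrightarrow> smooth_on_open U (\<lambda>x. f x * g x)"
  using U f by (simp add: smooth_on_open_def C_times_on_mult)

lemma smooth_on_open_uminus [smooth_intros]: "smooth_on_open U (\<lambda>x. - f x)"
  using U f by (simp add: smooth_on_open_def C_times_on_uminus)

lemma smooth_on_open_power [smooth_intros]: "smooth_on_open U (\<lambda>x. f x ^ n)"
  using U f by (induction n) (auto simp: smooth_on_open_def C_times_on_const C_times_on_mult)

lemma smooth_on_open_inverse:
  "(\<And>x. x \<in> U \<Longrightarrow> f x \<noteq> 0) \<Longrightarrow> smooth_on_open U (\<lambda>x. inverse (f x))"
  using U f by (simp add: smooth_on_open_def C_times_on_inverse)

lemma smooth_on_open_sqrt [smooth_intros]: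
  "(\<And>x. x \<in> U \<Longrightarrow> 0 < f x) \<Longrightarrow> smooth_on_open U (\<lambda>x. sqrt (f x))"
  using U f by (simp add: smooth_on_open_def C_times_on_sqrt)

lemma smooth_on_open_sin [smooth_intros]: "smooth_on_open U (\<lambda>x. sin (f x))"
  and smooth_on_open_cos [smooth_intros]: "smooth_on_open U (\<lambda>x. cos (f x))"
  using U f C_times_on_sin_cos by (auto simp: smooth_on_open_def)

end

lemma smooth_on_open_diff [smooth_intros]:
  fixes f g :: "'a::real_normed_vector \<Rightarrow> real"
  assumes "open U" "smooth_on_open U f" "smooth_on_open U g"
  shows "smooth_on_open U (\<lambda>x. f x - g x)"
  using smooth_on_open_add[OF assms(1,2) smooth_on_open_uminus[OF assms(1,3)]] by simp

lemma smooth_on_open_divide [smooth_intros]: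
  fixes f g :: "'a::real_normed_vector \<Rightarrow> real"
  assumes "open U" "smooth_on_open U f" "smooth_on_open U g" "\<And>x. x \<in> U \<Longrightarrow> g x \<noteq> 0"
  shows "smooth_on_open U (\<lambda>x. f x / g x)"
  using smooth_on_open_mult[OF assms(1,2) smooth_on_open_inverse[OF assms(1,3,4)]]
  by (simp add: divide_inverse)

lemma smooth_on_open_vec_lambda:
  fixes f :: "'a::euclidean_space \<Rightarrow> 'b::euclidean_space^'n"
  assumes "open U" "\<And>i. smooth_on_open U (\<lambda>x. f x $ i)"
  shows "smooth_on_open U f"
  using assms by (auto simp: smooth_on_open_def intro: C_times_on_vec_lambda)

section \<open>Lorentzian block matrices\<close>

lemma vector_4 [simp]:
  "(vector [x,y,z,w] :: ('a::zero)^4) $ 1 = x"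
  "(vector [x,y,z,w] :: ('a::zero)^4) $ 2 = y"
  "(vector [x,y,z,w] :: ('a::zero)^4) $ 3 = z"
  "(vector [x,y,z,w] :: ('a::zero)^4) $ 4 = w"
  unfolding vector_def by simp_all

text \<open>With coordinates \<open>(u, r, \<theta>, \<phi>)\<close> the arguments are the entries
  \<open>uu\<close>, \<open>ur\<close>, \<open>u\<phi>\<close>, \<open>rr\<close>,
  \<open>r\<phi>\<close>, \<open>\<phi>\<phi>\<close> and, last,
  \<open>\<theta>\<theta>\<close>.\<close>

definition block_matrix :: "real \<Rightarrow> real \<Rightarrow> real \<Rightarrow> real \<Rightarrow> real \<Rightarrow> real \<Rightarrow> real \<Rightarrow> real^4^4" where
  "block_matrix \<alpha> \<beta> \<gamma> \<delta> \<eta> \<zeta> \<tau> =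
     vector [vector [\<alpha>, \<beta>, 0, \<gamma>], vector [\<beta>, \<delta>, 0, \<eta>], vector [0, 0, \<tau>, 0], vector [\<gamma>, \<eta>, 0, \<zeta>]]"

text \<open>Determinant of the symmetric 3 by 3 block left after removing the \<theta> row and
  column.\<close>

definition block_det :: "real \<Rightarrow> real \<Rightarrow> real \<Rightarrow> real \<Rightarrow> real \<Rightarrow> real \<Rightarrow> real" where
  "block_det \<alpha> \<beta> \<gamma> \<delta> \<eta> \<zeta> = \<alpha> * \<delta> * \<zeta> + 2 * \<beta> * \<gamma> * \<eta> - \<alpha> * \<eta>^2 - \<delta> * \<gamma>^2 - \<zeta> * \<beta>^2"

lemmas block_simps = block_matrix_def matrix_matrix_mult_def mat_def transpose_def vec_eq_iff
  forall_4 sum_4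

text \<open>A binary quadratic form of negative discriminant \<open>p * r - q^2\<close> takes both
  signs. Diagonalizing it and normalizing gives an orthogonal pair with values \<open>- 1\<close>
  and \<open>1\<close>.\<close>

lemma indefinite_form_frame:
  fixes p q r :: real
  assumes "p * r - q^2 < 0"
  obtains x1 y1 x2 y2 where
    "p * x1^2 + 2 * q * x1 * y1 + r * y1^2 = - 1"
    "p * x2^2 + 2 * q * x2 * y2 + r * y2^2 = 1"
    "p * x1 * x2 + q * (x1 * y2 + x2 * y1) + r * y1 * y2 = 0"
proof (cases "p = 0")
  case True
  then have "q \<noteq> 0"
    using assms by auto
  \<comment> \<open>With \<open>p = 0\<close> and second coordinate 1, the form is
    \<open>2 * q * x + r\<close>, affine in \<open>x\<close>. Solving for the values
    \<open>- 1\<close> and \<open>1\<close> gives \<open>x1 + x2 = - r / q\<close>, which is exactly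
    orthogonality.\<close>
  then show ?thesis
    using that[of "(- 1 - r) / (2 * q)" 1 "(1 - r) / (2 * q)" 1] True by (simp add: field_simps)
next
  case p: False
  \<comment> \<open>The vectors \<open>(1, 0)\<close> and \<open>(- q, p)\<close> are orthogonal,
    with values \<open>p\<close> and \<open>- p * e^2\<close>. Dividing by \<open>l\<close> and by
    \<open>e * l\<close> turns these into \<open>sgn p\<close> and \<open>- sgn p\<close>; the sign
    of \<open>p\<close> decides their order.\<close>
  define e where "e = sqrt (q^2 - p * r)"
  have e: "e^2 = q^2 - p * r" "e \<noteq> 0"
    using assms by (simp_all add: e_def)
  define l where "l = sqrt \<bar>p\<bar>"
  have l: "l^2 = \<bar>p\<bar>" "l \<noteq> 0"
    using p by (simp_all add: l_def)
  have 1: "p * (1 / l)^2 + 2 * q * (1 / l) * 0 + r * 0^2 = sgn p"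
    using l p by (simp add: power_divide sgn_if)
  have "p * (- q / (e * l))^2 + 2 * q * (- q / (e * l)) * (p / (e * l)) + r * (p / (e * l))^2
      = - p * (q^2 - p * r) / (e^2 * l^2)"
    using p l e(2) by (simp add: field_simps power2_eq_square)
  also have "\<dots> = - p / l^2"
    using e by (metis nonzero_divide_mult_cancel_left times_divide_eq_left mult.commute power_not_zero mult_divide_mult_cancel_left)
  also have "\<dots> = - sgn p"
    using l p by (simp add: sgn_if)
  finally have 2: "p * (- q / (e * l))^2 + 2 * q * (- q / (e * l)) * (p / (e * l)) + r * (p / (e * l))^2 = - sgn p" .
  have 3: "p * (1 / l) * (- q / (e * l)) + q * ((1 / l) * (p / (e * l)) + (- q / (e * l)) * 0) + r * 0 * (p / (e * l)) = 0"
    by (simp add: field_simps)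
  show ?thesis
  proof (cases "p > 0")
    case True
    then show ?thesis
      using that[of "- q / (e * l)" "p / (e * l)" "1 / l" 0] 1 2 3 by (simp add: mult_ac)
  next
    case False
    then show ?thesis
      using that[of "1 / l" 0 "- q / (e * l)" "p / (e * l)"] 1 2 3 p by (simp add: sgn_if)
  qed
qed

lemma minkowski_square: "minkowski ** minkowski = mat 1"
  by (simp add: minkowski_def block_simps)

lemma transpose_minkowski: "transpose minkowski = minkowski"
  by (simp add: minkowski_def block_simps)

text \<open>Since \<open>minkowski\<close> squares to the identity, the congruence itself provides a
  left inverse of \<open>E\<close>.\<close>

lemma lorentzianI:
  assumes "transpose A = A" "transpose E ** A ** E = minkowski"
  shows "lorentzian A"
proof -
  have "(minkowski ** transpose E ** A) ** E = mat 1"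
    by (metis assms(2) minkowski_square matrix_mul_assoc)
  then have "invertible E"
    using invertible_left_inverse by blast
  then show ?thesis
    using assms by (auto simp: lorentzian_def)
qed

text \<open>Completing the square in \<phi>, possible as \<open>\<zeta> > 0\<close>, leaves a form
  in the first two coordinates with determinant \<open>block_det / \<zeta> < 0\<close>. Its frame,
  lifted orthogonally to the \<phi> axis, is completed by the normalized \<theta> and \<phi>
  axes.\<close>

lemma lorentzian_block_matrix:
  assumes "0 < \<tau>" "0 < \<zeta>" "block_det \<alpha> \<beta> \<gamma> \<delta> \<eta> \<zeta> < 0"
  shows "lorentzian (block_matrix \<alpha> \<beta> \<gamma> \<delta> \<eta> \<zeta> \<tau>)"
proof -
  \<comment> \<open>The entries of the Schur complement of \<open>\<zeta>\<close>.\<close>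
  define p q r where "p = \<alpha> - \<gamma>^2 / \<zeta>" and "q = \<beta> - \<gamma> * \<eta> / \<zeta>" and "r = \<delta> - \<eta>^2 / \<zeta>"
  note pqr = p_def q_def r_def
  have "p * r - q^2 = block_det \<alpha> \<beta> \<gamma> \<delta> \<eta> \<zeta> / \<zeta>"
    using assms(2) by (simp add: pqr block_det_def field_simps power2_eq_square)
  also have "\<dots> < 0"
    using assms(2,3) by (simp add: divide_neg_pos)
  finally obtain x1 y1 x2 y2 where xy:
    "p * x1^2 + 2 * q * x1 * y1 + r * y1^2 = - 1"
    "p * x2^2 + 2 * q * x2 * y2 + r * y2^2 = 1"
    "p * x1 * x2 + q * (x1 * y2 + x2 * y1) + r * y1 * y2 = 0"
    by (rule indefinite_form_frame)
  \<comment> \<open>This \<phi> component makes the lifted vector orthogonal to the \<phi>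
    axis.\<close>
  define z where "z x y = - (\<gamma> * x + \<eta> * y) / \<zeta>" for x y
  have z: "\<zeta> * z x y = - (\<gamma> * x + \<eta> * y)" for x y
    using assms(2) by (simp add: z_def)
  have form: "(\<alpha> * x + \<beta> * y + \<gamma> * z x y) * x' + (\<beta> * x + \<delta> * y + \<eta> * z x y) * y'
      = p * x * x' + q * (x * y' + x' * y) + r * y * y'" for x y x' y'
    using assms(2) by (simp add: z_def pqr field_simps power2_eq_square)
  define E :: "real^4^4" where "E = vector [vector [x1, x2, 0, 0], vector [y1, y2, 0, 0],
      vector [0, 0, 1 / sqrt \<tau>, 0], vector [z x1 y1, z x2 y2, 0, 1 / sqrt \<zeta>]]"
  have "block_matrix \<alpha> \<beta> \<gamma> \<delta> \<eta> \<zeta> \<tau> ** E = vector [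
      vector [\<alpha> * x1 + \<beta> * y1 + \<gamma> * z x1 y1, \<alpha> * x2 + \<beta> * y2 + \<gamma> * z x2 y2, 0, \<gamma> / sqrt \<zeta>],
      vector [\<beta> * x1 + \<delta> * y1 + \<eta> * z x1 y1, \<beta> * x2 + \<delta> * y2 + \<eta> * z x2 y2, 0, \<eta> / sqrt \<zeta>],
      vector [0, 0, sqrt \<tau>, 0], vector [0, 0, 0, sqrt \<zeta>]]" (is "_ = ?BE")
    using assms(1,2) z by (simp add: E_def block_simps real_div_sqrt)
  moreover have "transpose E ** ?BE = minkowski"
    using assms(1,2) xy form[of x1 y1 x1 y1] form[of x2 y2 x2 y2] form[of x1 y1 x2 y2] form[of x2 y2 x1 y1]
    by (simp add: E_def block_simps minkowski_def mult_ac power2_eq_square)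
       (simp add: z_def field_simps)
  ultimately have "transpose E ** block_matrix \<alpha> \<beta> \<gamma> \<delta> \<eta> \<zeta> \<tau> ** E = minkowski"
    by (simp add: matrix_mul_assoc[symmetric])
  moreover have "transpose (block_matrix \<alpha> \<beta> \<gamma> \<delta> \<eta> \<zeta> \<tau>) = block_matrix \<alpha> \<beta> \<gamma> \<delta> \<eta> \<zeta> \<tau>"
    by (simp add: block_simps)
  ultimately show ?thesis
    by (intro lorentzianI)
qed

section \<open>Inverses of Lorentzian and block matrices\<close>

lemma matrix_inv_eqI:
  fixes A B :: "real^'n^'n"
  assumes "A ** B = mat 1"
  shows "matrix_inv A = B"
  unfolding matrix_inv_def
proof (rule some_equality)
  show "A ** B = mat 1 \<and> B ** A = mat 1"
    using assms matrix_left_right_inverse by blast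
  show "C = B" if "A ** C = mat 1 \<and> C ** A = mat 1" for C
    by (metis assms that matrix_mul_assoc matrix_mul_lid matrix_mul_rid)
qed

text \<open>If \<open>E\<close> is an orthonormal frame for \<open>A\<close>, then
  \<open>A ** E ** minkowski\<close> is one for the inverse \<open>B\<close>: the product collapses
  to the cube of \<open>minkowski\<close>, which is \<open>minkowski\<close>.\<close>

lemma lorentzian_inverse:
  assumes "lorentzian A" "A ** B = mat 1"
  shows "lorentzian B"
proof -
  obtain E where E: "transpose A = A" "invertible E" "transpose E ** A ** E = minkowski"
    using assms(1) by (auto simp: lorentzian_def)
  have BA: "B ** A = mat 1"
    using assms(2) matrix_left_right_inverse by blast
  have "transpose B ** A = mat 1"
    using arg_cong[OF assms(2), of transpose] E(1) by (simp add: matrix_transpose_mul)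
  then have "transpose B = B"
    by (metis assms(2) matrix_mul_assoc matrix_mul_lid matrix_mul_rid)
  moreover have "transpose (A ** E ** minkowski) ** B ** (A ** E ** minkowski)
      = transpose minkowski ** (transpose E ** A ** (B ** A) ** E) ** minkowski"
    by (simp add: matrix_transpose_mul matrix_mul_assoc E(1))
  then have "transpose (A ** E ** minkowski) ** B ** (A ** E ** minkowski) = minkowski"
    by (simp add: BA E(3) transpose_minkowski minkowski_square)
  ultimately show ?thesis
    by (rule lorentzianI)
qed

lemma scaleR_block_matrix:
  "c *\<^sub>R block_matrix \<alpha> \<beta> \<gamma> \<delta> \<eta> \<zeta> \<tau>
   = block_matrix (c * \<alpha>) (c * \<beta>) (c * \<gamma>) (c * \<delta>) (c * \<eta>) (c * \<zeta>) (c * \<tau>)"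
  by (simp add: block_simps)

lemma block_det_scale:
  "block_det (c * \<alpha>) (c * \<beta>) (c * \<gamma>) (c * \<delta>) (c * \<eta>) (c * \<zeta>) = c^3 * block_det \<alpha> \<beta> \<gamma> \<delta> \<eta> \<zeta>"
  by (simp add: block_det_def algebra_simps power2_eq_square power3_eq_cube)

lemma lorentzian_scaleR_block_matrix:
  assumes "0 < c" "0 < \<tau>" "0 < \<zeta>" "block_det \<alpha> \<beta> \<gamma> \<delta> \<eta> \<zeta> < 0"
  shows "lorentzian (c *\<^sub>R block_matrix \<alpha> \<beta> \<gamma> \<delta> \<eta> \<zeta> \<tau>)"
  unfolding scaleR_block_matrix using assms
  by (intro lorentzian_block_matrix) (auto simp: block_det_scale intro: mult_pos_neg)

text \<open>Cramer's rule: the symmetric adjugate of the 3 by 3 block over its determinant, with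
  \<theta> inverted separately.\<close>

definition block_inverse :: "real \<Rightarrow> real \<Rightarrow> real \<Rightarrow> real \<Rightarrow> real \<Rightarrow> real \<Rightarrow> real \<Rightarrow> real^4^4" where
  "block_inverse \<alpha> \<beta> \<gamma> \<delta> \<eta> \<zeta> \<tau> = (let D = block_det \<alpha> \<beta> \<gamma> \<delta> \<eta> \<zeta> in
     block_matrix ((\<delta> * \<zeta> - \<eta>^2) / D) ((\<gamma> * \<eta> - \<beta> * \<zeta>) / D) ((\<beta> * \<eta> - \<gamma> * \<delta>) / D)
       ((\<alpha> * \<zeta> - \<gamma>^2) / D) ((\<beta> * \<gamma> - \<alpha> * \<eta>) / D) ((\<alpha> * \<delta> - \<beta>^2) / D) (1 / \<tau>))"

lemma block_matrix_mult_inverse: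
  assumes "block_det \<alpha> \<beta> \<gamma> \<delta> \<eta> \<zeta> \<noteq> 0" "\<tau> \<noteq> 0"
  shows "block_matrix \<alpha> \<beta> \<gamma> \<delta> \<eta> \<zeta> \<tau> ** block_inverse \<alpha> \<beta> \<gamma> \<delta> \<eta> \<zeta> \<tau> = mat 1"
proof -
  \<comment> \<open>\<open>D\<close> stays opaque while denominators are cleared and is expanded
    only for the final polynomial identities.\<close>
  define D where "D = block_det \<alpha> \<beta> \<gamma> \<delta> \<eta> \<zeta>"
  have D: "D \<noteq> 0" "D = \<alpha> * \<delta> * \<zeta> + 2 * \<beta> * \<gamma> * \<eta> - \<alpha> * \<eta>^2 - \<delta> * \<gamma>^2 - \<zeta> * \<beta>^2"
    using assms(1) by (simp_all add: D_def block_det_def)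
  show ?thesis
    unfolding block_inverse_def D_def[symmetric] Let_def using assms(2) D(1)
    by (simp add: block_simps add_divide_distrib[symmetric] divide_simps)
      (simp add: D(2) algebra_simps power2_eq_square)
qed

lemma matrix_mult_scaleR_inverse:
  fixes A B :: "real^'n^'n"
  assumes "A ** B = mat 1" "c \<noteq> 0"
  shows "((1 / c) *\<^sub>R A) ** (c *\<^sub>R B) = mat 1"
  using assms by (simp add: scalar_matrix_assoc[symmetric] matrix_scalar_ac)

section \<open>Shear charts and null boundaries\<close>

text \<open>The common shape of the outgoing chart, where \<open>g\<close> is the identity, and the
  compactified chart, where \<open>g\<close> is the radial function \<rho>.\<close>

definition shear_chart :: "(real \<Rightarrow> real) \<Rightarrow> (real \<Rightarrow> real) \<Rightarrow> (real \<Rightarrow> real) \<Rightarrow> real^4 \<Rightarrow> real^4" where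
  "shear_chart f g k x = vector [x $ 1 - f (x $ 2), g (x $ 2), x $ 3, x $ 4 - k (x $ 2)]"

text \<open>The Jacobian of a shear chart, with \<open>b\<close>, \<open>c\<close>, \<open>d\<close>
  the derivatives of \<open>f\<close>, \<open>g\<close>, \<open>k\<close>.\<close>

definition shear_matrix :: "real \<Rightarrow> real \<Rightarrow> real \<Rightarrow> real^4^4" where
  "shear_matrix b c d =
     vector [vector [1, - b, 0, 0], vector [0, c, 0, 0], vector [0, 0, 1, 0], vector [0, - d, 0, 1]]"

lemma has_derivative_shear_chart:
  assumes "(f has_real_derivative f') (at (x $ 2))" "(g has_real_derivative g') (at (x $ 2))"
    "(k has_real_derivative k') (at (x $ 2))"
  shows "(shear_chart f g k has_derivative (*v) (shear_matrix f' g' k')) (at x)"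
proof -
  have nth: "((\<lambda>x::real^4. x $ i) has_derivative (\<lambda>h. h $ i)) (at x)" for i
    by (intro bounded_linear_imp_has_derivative bounded_linear_vec_nth)
  have comp: "((\<lambda>x::real^4. \<phi> (x $ 2)) has_derivative (\<lambda>h. h $ 2 * \<phi>')) (at x)"
    if "(\<phi> has_real_derivative \<phi>') (at (x $ 2))" for \<phi> \<phi>'
    by (rule DERIV_compose_FDERIV[OF that nth])
  have "\<forall>i. ((\<lambda>x. shear_chart f g k x $ i) has_derivative (\<lambda>h. (shear_matrix f' g' k' *v h) $ i)) (at x)"
    unfolding forall_4 shear_chart_def shear_matrix_def matrix_vector_mult_def
    using has_derivative_diff[OF nth[of 1] comp[OF assms(1)]] comp[OF assms(2)] nth[of 3]
      has_derivative_diff[OF nth[of 4] comp[OF assms(3)]]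
    by (simp add: sum_4 mult.commute)
  then show ?thesis
    using has_derivative_vec_lambda[of "shear_chart f g k" "\<lambda>i h. (shear_matrix f' g' k' *v h) $ i" x]
    by simp
qed

lemma shear_chart_image:
  assumes "g r = p $ 2" "vector [p $ 1 + f r, r, p $ 3, p $ 4 + k r] \<in> M"
  shows "p \<in> shear_chart f g k ` M"
  using assms(1) by (intro image_eqI[OF _ assms(2)]) (simp add: shear_chart_def vec_eq_iff forall_4)

lemma inj_on_shear_chart:
  assumes "inj_on g ((\<lambda>x. x $ 2) ` M)"
  shows "inj_on (shear_chart f g k) M"
proof (rule inj_onI)
  fix x y assume xy: "x \<in> M" "y \<in> M" "shear_chart f g k x = shear_chart f g k y"
  then have "g (x $ 2) = g (y $ 2)"
    by (simp add: shear_chart_def vec_eq_iff forall_4)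
  then have "x $ 2 = y $ 2"
    using assms xy by (auto dest: inj_onD)
  then show "x = y"
    using xy(3) by (simp add: shear_chart_def vec_eq_iff forall_4)
qed

text \<open>This is how a contravariant 2-tensor transforms under a shear chart; the zero pattern
  survives because \<theta> is left fixed.\<close>

lemma shear_congruence_block_matrix:
  "shear_matrix b c d ** block_matrix \<alpha> \<beta> \<gamma> \<delta> \<eta> \<zeta> \<tau> ** transpose (shear_matrix b c d) =
   block_matrix (\<alpha> - 2 * b * \<beta> + b^2 * \<delta>) (c * (\<beta> - b * \<delta>)) (\<gamma> - b * \<eta> - d * (\<beta> - b * \<delta>))
     (c^2 * \<delta>) (c * (\<eta> - d * \<delta>)) (\<zeta> - 2 * d * \<eta> + d^2 * \<delta>) \<tau>"
  by (simp add: shear_matrix_def block_simps) (simp add: algebra_simps power2_eq_square)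

text \<open>Connects the transformation law of the inverse metric with the pullback of the metric.
  \<open>J\<close> can be moved to the other end of the product because one-sided inverses of square
  matrices are two-sided.\<close>

lemma inverse_congruence:
  fixes A B J :: "real^'n^'n"
  assumes "J ** A ** transpose J ** B = mat 1"
  shows "A ** (transpose J ** B ** J) = mat 1"
proof -
  have "J ** (A ** transpose J ** B) = mat 1"
    using assms by (simp add: matrix_mul_assoc)
  then have "(A ** transpose J ** B) ** J = mat 1"
    using matrix_left_right_inverse by blast
  then show ?thesis
    by (simp add: matrix_mul_assoc)
qed

section \<open>Smooth families of block matrices and a criterion for null boundaries\<close>

lemma smooth_on_open_block_matrix:
  assumes "open U" "smooth_on_open U \<alpha>" "smooth_on_open U \<beta>" "smooth_on_open U \<gamma>"
    "smooth_on_open U \<delta>" "smooth_on_open U \<eta>" "smooth_on_open U \<zeta>" "smooth_on_open U \<tau>"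
  shows "smooth_on_open U (\<lambda>p::real^4. block_matrix (\<alpha> p) (\<beta> p) (\<gamma> p) (\<delta> p) (\<eta> p) (\<zeta> p) (\<tau> p))"
proof -
  have "\<forall>i j. smooth_on_open U (\<lambda>p. block_matrix (\<alpha> p) (\<beta> p) (\<gamma> p) (\<delta> p) (\<eta> p) (\<zeta> p) (\<tau> p) $ i $ j)"
    unfolding forall_4 block_matrix_def using assms by (simp add: smooth_on_open_const)
  then show ?thesis
    using assms(1) by (intro smooth_on_open_vec_lambda) auto
qed

lemma smooth_on_open_block_inverse:
  assumes "open U" "smooth_on_open U \<alpha>" "smooth_on_open U \<beta>" "smooth_on_open U \<gamma>"
    "smooth_on_open U \<delta>" "smooth_on_open U \<eta>" "smooth_on_open U \<zeta>" "smooth_on_open U \<Omega>"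
    and "\<And>p. p \<in> U \<Longrightarrow> block_det (\<alpha> p) (\<beta> p) (\<gamma> p) (\<delta> p) (\<eta> p) (\<zeta> p) \<noteq> 0"
  shows "smooth_on_open U (\<lambda>p::real^4. \<Omega> p *\<^sub>R block_inverse (\<alpha> p) (\<beta> p) (\<gamma> p) (\<delta> p) (\<eta> p) (\<zeta> p) 1)"
proof -
  have "smooth_on_open U (\<lambda>p. block_det (\<alpha> p) (\<beta> p) (\<gamma> p) (\<delta> p) (\<eta> p) (\<zeta> p))"
    unfolding block_det_def by (intro smooth_intros assms(1-8))
  then show ?thesis
    unfolding block_inverse_def Let_def scaleR_block_matrix
    using assms by (intro smooth_on_open_block_matrix smooth_intros) auto
qed

text \<open>Serves both the horizon and null infinity. \<open>A\<close> is the inverse metric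
  without its conformal factor \<open>q\<close>, in the given coordinates; the Greek functions are
  its entries in the chart \<Psi>, and \<open>\<Omega>\<close> is the total conformal factor of the
  extended metric \<open>G\<close>.\<close>

lemma null_boundaryI:
  fixes \<alpha> \<beta> \<gamma> \<delta> \<eta> \<zeta> \<Omega> :: "real^4 \<Rightarrow> real"
  defines "G \<equiv> \<lambda>p. \<Omega> p *\<^sub>R block_inverse (\<alpha> p) (\<beta> p) (\<gamma> p) (\<delta> p) (\<eta> p) (\<zeta> p) 1"
  assumes U: "open U" "\<Psi> ` M \<union> level_set c \<subseteq> U"
    and smooth: "smooth_on_open U \<alpha>" "smooth_on_open U \<beta>" "smooth_on_open U \<gamma>"
      "smooth_on_open U \<delta>" "smooth_on_open U \<eta>" "smooth_on_open U \<zeta>" "smooth_on_open U \<Omega>"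
    and sign: "\<And>p. p \<in> U \<Longrightarrow> 0 < \<Omega> p" "\<And>p. p \<in> U \<Longrightarrow> 0 < \<zeta> p"
      "\<And>p. p \<in> U \<Longrightarrow> block_det (\<alpha> p) (\<beta> p) (\<gamma> p) (\<delta> p) (\<eta> p) (\<zeta> p) < 0"
    and inj: "inj_on \<Psi> M"
    and cover: "\<exists>\<epsilon>>0. {p. c < p $ 2 \<and> p $ 2 < c + \<epsilon> \<and> 0 < p $ 3 \<and> p $ 3 < pi} \<subseteq> \<Psi> ` M"
    and metric: "\<And>x. x \<in> M \<Longrightarrow> g x = matrix_inv ((1 / q x) *\<^sub>R A x)"
      "\<And>x. x \<in> M \<Longrightarrow> q x \<noteq> 0" "\<And>x. x \<in> M \<Longrightarrow> \<Omega> (\<Psi> x) = \<omega> x * q x"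
    and \<Psi>: "\<And>x. x \<in> M \<Longrightarrow> \<exists>J. (\<Psi> has_derivative (*v) J) (at x) \<and>
      J ** A x ** transpose J = block_matrix (\<alpha> (\<Psi> x)) (\<beta> (\<Psi> x)) (\<gamma> (\<Psi> x)) (\<delta> (\<Psi> x)) (\<eta> (\<Psi> x)) (\<zeta> (\<Psi> x)) 1"
    and timelike: "\<And>p. p \<in> \<Psi> ` M \<Longrightarrow> \<eta> p ^ 2 < \<delta> p * \<zeta> p"
    and boundary: "\<And>p. p \<in> level_set c \<Longrightarrow> \<delta> p = 0" "\<And>p. p \<in> level_set c \<Longrightarrow> \<eta> p = 0"
  shows "smooth_null_boundary g \<omega> M \<Psi> c U G"
    and "p \<in> level_set c \<Longrightarrow> future_timelike G p W \<Longrightarrow> \<beta> p * W $ 2 < 0"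
proof -
  define D where "D p = block_det (\<alpha> p) (\<beta> p) (\<gamma> p) (\<delta> p) (\<eta> p) (\<zeta> p)" for p
  define B where "B p = block_matrix (\<alpha> p) (\<beta> p) (\<gamma> p) (\<delta> p) (\<eta> p) (\<zeta> p) 1" for p
  define C where "C p = block_inverse (\<alpha> p) (\<beta> p) (\<gamma> p) (\<delta> p) (\<eta> p) (\<zeta> p) 1" for p
  have G: "G p = \<Omega> p *\<^sub>R C p" for p
    by (simp add: G_def C_def)
  have BC: "B p ** C p = mat 1" if "p \<in> U" for p
    using sign(3)[OF that] unfolding B_def C_def by (intro block_matrix_mult_inverse) auto
  have "smooth_on_open U G"
    unfolding G_def by (rule smooth_on_open_block_inverse[OF U(1) smooth]) (use sign(3) in force)
  moreover have "lorentzian (G p)" if "p \<in> U" for p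
  proof -
    have "lorentzian ((1 / \<Omega> p) *\<^sub>R B p)"
      unfolding B_def using sign[OF that] by (intro lorentzian_scaleR_block_matrix) auto
    then show ?thesis
      unfolding G
      by (rule lorentzian_inverse)
        (use matrix_mult_scaleR_inverse[OF BC[OF that], of "\<Omega> p"] sign(1)[OF that] in auto)
  qed
  moreover have "\<Psi> differentiable (at x) \<and> \<omega> x *\<^sub>R g x = pullback \<Psi> G x" if "x \<in> M" for x
  proof -
    obtain J where J: "(\<Psi> has_derivative (*v) J) (at x)" "J ** A x ** transpose J = B (\<Psi> x)"
      using \<Psi>[OF \<open>x \<in> M\<close>] by (auto simp: B_def)
    have "\<Psi> x \<in> U"
      using U(2) that by auto
    then have "A x ** (transpose J ** C (\<Psi> x) ** J) = mat 1"
      using BC by (intro inverse_congruence) (simp add: J(2))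
    then have "g x = q x *\<^sub>R (transpose J ** C (\<Psi> x) ** J)"
      unfolding metric(1)[OF that]
      by (intro matrix_inv_eqI matrix_mult_scaleR_inverse metric(2)[OF that])
    moreover have "jacobian \<Psi> (at x) = J"
      unfolding jacobian_def frechet_derivative_at[OF J(1), symmetric] by simp
    ultimately have "\<omega> x *\<^sub>R g x = pullback \<Psi> G x"
      by (simp add: pullback_def G metric(3)[OF that] scalar_matrix_assoc[symmetric] matrix_scalar_ac)
    then show ?thesis
      using Derivative.differentiableI[OF J(1)] by simp
  qed
  \<comment> \<open>The \<open>uu\<close> entry of \<open>G\<close> is \<open>\<Omega>\<close> times
    the minor \<open>\<delta> * \<zeta> - \<eta>^2\<close> over the negative determinant.\<close>
  moreover have "G p $ 1 $ 1 < 0" if "p \<in> \<Psi> ` M" for p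
  proof -
    have "p \<in> U"
      using U(2) that by auto
    moreover have "G p $ 1 $ 1 = \<Omega> p * ((\<delta> p * \<zeta> p - (\<eta> p)^2) / D p)"
      by (simp add: G_def block_inverse_def block_matrix_def D_def Let_def)
    ultimately show ?thesis
      using timelike[OF that] sign[of p]
      by (auto simp: D_def intro!: mult_pos_neg divide_pos_neg)
  qed
  \<comment> \<open>With \<open>\<delta> = \<eta> = 0\<close> the determinant is
    \<open>- \<zeta> * \<beta>^2\<close>, so \<open>\<beta>\<close> is nonzero and the first row of
    \<open>G\<close> has the single nonzero entry \<open>\<Omega> / \<beta>\<close>, in the second
    column.\<close>
  moreover have bd: "\<beta> p \<noteq> 0 \<and> axis 1 1 \<bullet> (G p *v W) = \<Omega> p * (W $ 2 / \<beta> p)" if "p \<in> level_set c" for p W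
  proof -
    have "p \<in> U"
      using U(2) that by auto
    then have "block_det (\<alpha> p) (\<beta> p) (\<gamma> p) (\<delta> p) (\<eta> p) (\<zeta> p) \<noteq> 0" "\<zeta> p \<noteq> 0"
      using sign(2,3)[of p] by auto
    then show ?thesis
      using boundary[OF that]
      by (simp add: block_det_def G_def block_inverse_def block_matrix_def inner_axis'
          matrix_vector_mult_def sum_4 power2_eq_square)
  qed
  moreover have "null_level_at G p" if "p \<in> level_set c" for p
    unfolding null_level_at_def using bd[OF that]
    by (intro exI[of _ "axis 1 1"]) (auto simp: axis_def vec_eq_iff)
  ultimately show "smooth_null_boundary g \<omega> M \<Psi> c U G"
    using U inj cover by (simp add: smooth_null_boundary_def)
  show "\<beta> p * W $ 2 < 0" if p: "p \<in> level_set c" and W: "future_timelike G p W"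
  proof -
    have "p \<in> U"
      using U(2) p by auto
    moreover have "\<Omega> p * (W $ 2 / \<beta> p) < 0"
      using W bd[OF p, of W] by (simp add: future_timelike_def)
    ultimately have "W $ 2 / \<beta> p < 0"
      using sign(1)[of p] by (metis mult_less_0_iff less_asym)
    then show ?thesis
      by (auto simp: divide_less_0_iff mult_less_0_iff)
  qed
qed

section \<open>The transformed metric in outgoing coordinates\<close>

text \<open>The tensor \<open>O_inv\<close> contributes \<open>a^2 * sin^2\<close> to the
  \<open>vv\<close> entry, \<open>a\<close> to \<open>v\<phi>\<close>, which turns
  \<open>a * X\<close> into \<open>a * (X + 1)\<close>, and the whole
  \<open>\<theta>\<theta>\<close> and \<open>\<phi>\<phi>\<close> entries.\<close>

lemma inverse_metric_block_matrix:
  fixes x :: "real^4"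
  assumes "X = X_fun S Rt (x $ 2)" "sin (x $ 3) \<noteq> 0"
  shows "h_inv m a S R Rt x + O_inv a x =
    block_matrix (Delta m a R * X^2 + 2 * (R^2 + a^2) * X + a^2 * (sin (x $ 3))^2)
      (((R - m) * X^2 + 2 * R * X) / S) (a * (X + 1)) (X * (X + 2) / S^2) 0 (1 / (sin (x $ 3))^2) 1"
  using assms(2)
  by (simp add: h_inv_def O_inv_def tensor_square_def block_matrix_def vec_eq_iff forall_4 axis_def
      Let_def assms(1)[symmetric] power2_eq_square algebra_simps)

lemma block_det_inverse_metric:
  fixes S s :: real
  assumes "S \<noteq> 0" "sin \<theta> \<noteq> 0"
  shows "block_det (Delta m a R * X^2 + 2 * (R^2 + a^2) * X + a^2 * (sin \<theta>)^2)
      (((R - m) * X^2 + 2 * R * X) / S) (a * (X + 1)) (X * (X + 2) / S^2) 0 (1 / (sin \<theta>)^2)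
    = X^2 * P_fun m a X \<theta> / (S^2 * (sin \<theta>)^2)"
proof -
  define s A n where "s = (sin \<theta>)^2" and "A = Delta m a R * X^2 + 2 * (R^2 + a^2) * X"
    and "n = (R - m) * X^2 + 2 * R * X"
  have "(cos \<theta>)^2 = 1 - s"
    by (simp add: s_def cos_squared_eq)
  then have "(A + a^2 * s) * X * (X + 2) - X * (X + 2) * (a * (X + 1))^2 * s - n^2 = X^2 * P_fun m a X \<theta>"
    unfolding P_fun_def Delta_def A_def n_def by algebra
  moreover have "block_det (A + a^2 * s) (n / S) (a * (X + 1)) (X * (X + 2) / S^2) 0 (1 / s)
     = ((A + a^2 * s) * X * (X + 2) - X * (X + 2) * (a * (X + 1))^2 * s - n^2) / (S^2 * s)"
  proof -
    have "s \<noteq> 0"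
      using assms(2) by (simp add: s_def)
    then show ?thesis
      using assms(1) by (simp add: block_det_def power_divide divide_simps)
  qed
  ultimately show ?thesis
    unfolding s_def A_def n_def by simp
qed

text \<open>The sign of \<open>P_fun\<close> is that of the block determinant. Working in the given
  coordinates, which are regular at \<open>X = - 2\<close>, includes the horizon.\<close>

lemma lorentzian_gt:
  fixes x :: "real^4"
  assumes "S \<noteq> 0" "X_fun S Rt (x $ 2) \<noteq> 0" "P_fun m a (X_fun S Rt (x $ 2)) (x $ 3) < 0" "sin (x $ 3) \<noteq> 0"
  shows "lorentzian (gt m a S R Rt x)"
proof -
  define X where "X = X_fun S Rt (x $ 2)"
  have "X^2 * P_fun m a X (x $ 3) / (S^2 * (sin (x $ 3))^2) < 0"
    using assms by (simp add: X_def divide_neg_pos mult_pos_neg)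
  then have neg: "block_det (Delta m a R * X^2 + 2 * (R^2 + a^2) * X + a^2 * (sin (x $ 3))^2)
      (((R - m) * X^2 + 2 * R * X) / S) (a * (X + 1)) (X * (X + 2) / S^2) 0 (1 / (sin (x $ 3))^2) < 0"
    unfolding block_det_inverse_metric[OF assms(1,4)] .
  define B where "B = h_inv m a S R Rt x + O_inv a x"
  note B = B_def[unfolded inverse_metric_block_matrix[OF X_def assms(4)]]
  have q: "0 < qt_sq m a S Rt x"
    using assms by (simp add: qt_sq_def Let_def)
  have "lorentzian ((1 / qt_sq m a S Rt x) *\<^sub>R B)"
    unfolding B by (rule lorentzian_scaleR_block_matrix[OF _ _ _ neg]) (use q assms(4) in auto)
  moreover obtain C where "B ** C = mat 1"
    unfolding B using block_matrix_mult_inverse neg by (metis less_irrefl zero_neq_one)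
  then have "((1 / qt_sq m a S Rt x) *\<^sub>R B) ** (qt_sq m a S Rt x *\<^sub>R C) = mat 1"
    by (rule matrix_mult_scaleR_inverse) (use q in auto)
  ultimately show ?thesis
    unfolding gt_def B_def[symmetric] by (metis lorentzian_inverse matrix_inv_eqI)
qed

text \<open>With \<open>b = \<bar>a * cos \<theta>\<bar>\<close>, \<open>P_fun\<close> is the
  difference of squares \<open>(b * (X + 2))^2 - (m * X)^2\<close>, and \<open>X_plus\<close> solves
  \<open>b * (X + 2) = m * X\<close>.\<close>

lemma P_fun_neg:
  assumes "\<bar>a\<bar> < m" "X \<le> - 2 \<or> X_plus m a \<theta> < X"
  shows "P_fun m a X \<theta> < 0"
proof -
  define b where "b = \<bar>a * cos \<theta>\<bar>"
  have "b \<le> \<bar>a\<bar>"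
    by (simp add: b_def abs_mult mult_left_le)
  then have b: "0 \<le> b" "b < m"
    using assms(1) by (auto simp: b_def)
  have P: "P_fun m a X \<theta> = (b * (X + 2))^2 - (m * X)^2"
    by (simp add: P_fun_def b_def power_mult_distrib algebra_simps power2_eq_square)
  have "\<bar>b * (X + 2)\<bar> < \<bar>m * X\<bar>"
    using assms(2)
  proof
    assume X: "X \<le> - 2"
    have "b * \<bar>X + 2\<bar> \<le> m * \<bar>X + 2\<bar>"
      using b by (intro mult_right_mono) auto
    also have "\<dots> < m * \<bar>X\<bar>"
      using b X by (intro mult_strict_left_mono) auto
    finally show ?thesis
      using b by (simp add: abs_mult)
  next
    assume X: "X_plus m a \<theta> < X"
    then have "2 * b < X * (m - b)"
      using b by (simp add: X_plus_def b_def field_simps)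
    moreover have "0 \<le> X_plus m a \<theta>"
      using b by (simp add: X_plus_def b_def)
    ultimately have "0 < X" "b * (X + 2) < m * X"
      using X by (auto simp: algebra_simps)
    then show ?thesis
      using b by (simp add: abs_mult)
  qed
  then show ?thesis
    using abs_le_square_iff[of "m * X" "b * (X + 2)"] P by linarith
qed

lemma X_plus_nonneg: "\<bar>a\<bar> < m \<Longrightarrow> 0 \<le> X_plus m a \<theta>"
proof -
  assume "\<bar>a\<bar> < m"
  moreover have "\<bar>a * cos \<theta>\<bar> \<le> \<bar>a\<bar>"
    by (simp add: abs_mult mult_left_le)
  ultimately show ?thesis
    by (simp add: X_plus_def)
qed

text \<open>Here \<open>b\<close> and \<open>d\<close> are \<open>- du/dr\<close> and \<open>- d\<phi>\<^sub>-/dr\<close>; the vanishing of \<open>h\<^sup>u\<^sup>u\<close>, which also eliminates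
  \<open>R\<close>, is what the choice of \<open>u\<close> achieves.\<close>

lemma outgoing_congruence:
  fixes m a S R X y \<kappa> \<sigma> \<theta> c :: real
  assumes "S \<noteq> 0" "X \<noteq> 0" "X + 2 \<noteq> 0" "sin \<theta> \<noteq> 0" "\<kappa> \<noteq> 0" "\<kappa>^2 = m^2 - a^2" "y^2 = Q_fun m a X" "\<sigma>^2 = 1"
  defines "b \<equiv> S * ((R - m) * X + 2 * R) / (X + 2) + S * y / (X + 2)"
    and "d \<equiv> \<sigma> * (a * S / (\<kappa> * X))"
  shows "shear_matrix b c d
      ** block_matrix (Delta m a R * X^2 + 2 * (R^2 + a^2) * X + a^2 * (sin \<theta>)^2)
      (((R - m) * X^2 + 2 * R * X) / S) (a * (X + 1)) (X * (X + 2) / S^2) 0 (1 / (sin \<theta>)^2) 1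
      ** transpose (shear_matrix b c d) =
    block_matrix (a^2 * (sin \<theta>)^2) (c * (- X * y / S)) (a * (X + 1) + \<sigma> * a * y / \<kappa>)
      (c^2 * (X * (X + 2) / S^2)) (c * (- \<sigma> * a * (X + 2) / (\<kappa> * S)))
      (1 / (sin \<theta>)^2 + a^2 * (X + 2) / (\<kappa>^2 * X)) 1"
proof -
  have \<beta>: "((R - m) * X^2 + 2 * R * X) / S - b * (X * (X + 2) / S^2) = - X * y / S"
    using assms(1-3) unfolding b_def by (simp add: divide_simps) (simp add: algebra_simps power2_eq_square)
  \<comment> \<open>\<open>l\<close> is \<open>b / S\<close>. Multiplied by \<open>X + 2\<close>,
    the part of the \<open>uu\<close> entry not coming from \<open>O_inv\<close> becomes a
    polynomial in \<open>l * (X + 2)\<close> that vanishes by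
    \<open>y^2 = Q_fun m a X\<close>.\<close>
  define l where "l = ((R - m) * X + 2 * R + y) / (X + 2)"
  have l: "b = S * l" "l * (X + 2) = (R - m) * X + 2 * R + y"
    using assms(3) by (simp add: b_def l_def add_divide_distrib[symmetric] distrib_left, simp add: l_def)
  have "(Delta m a R * X^2 + 2 * (R^2 + a^2) * X - 2 * b * (((R - m) * X^2 + 2 * R * X) / S) + b^2 * (X * (X + 2) / S^2)) * (X + 2)
     = (Delta m a R * X^2 + 2 * (R^2 + a^2) * X) * (X + 2) - 2 * (l * (X + 2)) * ((R - m) * X^2 + 2 * R * X) + (l * (X + 2))^2 * X"
    using assms(1) unfolding l(1) by (simp add: field_simps power2_eq_square)
  also have "\<dots> = 0"
    using assms(7) unfolding l(2) Delta_def Q_fun_def by algebra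
  finally have \<alpha>: "Delta m a R * X^2 + 2 * (R^2 + a^2) * X + a^2 * (sin \<theta>)^2 - 2 * b * (((R - m) * X^2 + 2 * R * X) / S)
      + b^2 * (X * (X + 2) / S^2) = a^2 * (sin \<theta>)^2"
    using assms(3) by simp
  have \<gamma>: "d * (- X * y / S) = - \<sigma> * a * y / \<kappa>" and \<eta>: "0 - d * (X * (X + 2) / S^2) = - \<sigma> * a * (X + 2) / (\<kappa> * S)"
    using assms(1,2,5) by (simp_all add: d_def field_simps power2_eq_square)
  have \<zeta>: "d^2 * (X * (X + 2) / S^2) = a^2 * (X + 2) / (\<kappa>^2 * X)"
    using assms(1,2,5,8) by (simp add: d_def power_mult_distrib power_divide) (simp add: field_simps power2_eq_square)
  show ?thesis
    unfolding shear_congruence_block_matrix \<beta> \<alpha> \<gamma> \<eta> using \<zeta> by simp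
qed

lemma sq_less_sq: "\<bar>a\<bar> < m \<Longrightarrow> a^2 < m^2" for a m :: real
  by (metis abs_ge_zero power2_abs power_strict_mono zero_less_numeral)

text \<open>\<open>Q_fun\<close> is the sum of \<open>(m^2 - a^2) * X^2 > 0\<close> and
  \<open>4 * a^2 * (- X - 1) \<ge> 0\<close>.\<close>

lemma Q_fun_pos:
  assumes "\<bar>a\<bar> < m" "X \<le> - 2"
  shows "0 < Q_fun m a X"
proof -
  have "a^2 < m^2"
    using assms(1) by (rule sq_less_sq)
  then have "0 < (m^2 - a^2) * X^2"
    using assms(2) by (intro mult_pos_pos) auto
  moreover have "0 \<le> a^2 * (- X - 1)"
    using assms(2) by (intro mult_nonneg_nonneg) auto
  ultimately show ?thesis
    by (simp add: Q_fun_def algebra_simps)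
qed

section \<open>The outgoing and compactified charts as shears\<close>

lemma outgoing_chart_eq:
  "outgoing_chart \<sigma> rs w k = shear_chart (\<lambda>r. rs r + \<sigma> * w r) (\<lambda>r. r) (\<lambda>r. \<sigma> * k r)"
  by (simp add: fun_eq_iff outgoing_chart_def shear_chart_def diff_diff_eq)

lemma compactified_chart_eq:
  "compactified_chart S Rt \<sigma> rs w k =
   shear_chart (\<lambda>r. rs r + \<sigma> * w r) (\<lambda>r. 1 / \<bar>X_fun S Rt r + 1\<bar>) (\<lambda>r. \<sigma> * k r)"
  by (simp add: fun_eq_iff compactified_chart_def outgoing_chart_def shear_chart_def Let_def diff_diff_eq)

text \<open>The radial coordinate \<open>g\<close> is left general, so that one computation covers
  both charts.\<close>

lemma outgoing_chart_jacobian: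
  fixes x :: "real^4"
  assumes X_def: "X = X_fun S Rt (x $ 2)" and \<kappa>_def: "\<kappa> = sqrt (m^2 - a^2)"
    and a: "\<bar>a\<bar> < m" and S: "S < 0" and int: "outgoing_integrals m a S R Rt I rs w k" "x $ 2 \<in> I"
    and sin: "sin (x $ 3) \<noteq> 0"
    and \<sigma>: "\<sigma> = 1 \<and> X < - 2 \<or> \<sigma> = - 1 \<and> 0 < X"
    and Q: "0 < Q_fun m a X"
    and g: "(g has_real_derivative c) (at (x $ 2))"
  shows "\<exists>J. (shear_chart (\<lambda>r. rs r + \<sigma> * w r) g (\<lambda>r. \<sigma> * k r) has_derivative (*v) J) (at x) \<and>
    J ** (h_inv m a S R Rt x + O_inv a x) ** transpose J =
    block_matrix (a^2 * (sin (x $ 3))^2) (c * (- X * sqrt (Q_fun m a X) / S))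
      (a * (X + 1) + \<sigma> * a * sqrt (Q_fun m a X) / \<kappa>)
      (c^2 * (X * (X + 2) / S^2)) (c * (- \<sigma> * a * (X + 2) / (\<kappa> * S)))
      (1 / (sin (x $ 3))^2 + a^2 * (X + 2) / (\<kappa>^2 * X)) 1"
proof -
  have "a^2 < m^2"
    using a by (rule sq_less_sq)
  then have \<kappa>: "0 < \<kappa>" "\<kappa>^2 = m^2 - a^2"
    by (simp_all add: \<kappa>_def)
  have r: "x $ 2 - Rt = X / S" "x $ 2 - Rt + 2 / S = (X + 2) / S"
    using S by (simp_all add: X_def X_fun_def field_simps)
  have der: "(rs has_real_derivative ((R - m) * X + 2 * R) / ((X + 2) / S)) (at (x $ 2))"
    "(w has_real_derivative sqrt (Q_fun m a X) / \<bar>(X + 2) / S\<bar>) (at (x $ 2))"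
    "(k has_real_derivative a / \<kappa> * (1 / (X / S))) (at (x $ 2))"
    using int unfolding outgoing_integrals_def X_def \<kappa>_def r[unfolded X_def, symmetric] by simp_all
  \<comment> \<open>In both regions \<sigma> is the sign of \<open>(X + 2) / S\<close>, so the
    absolute value disappears and \<open>b\<close> has one formula.\<close>
  have "\<sigma> * (sqrt (Q_fun m a X) / \<bar>(X + 2) / S\<bar>) = S * sqrt (Q_fun m a X) / (X + 2)"
    using \<sigma> S by (auto simp: abs_if field_simps)
  then have 1: "((\<lambda>r. rs r + \<sigma> * w r) has_real_derivative
      S * ((R - m) * X + 2 * R) / (X + 2) + S * sqrt (Q_fun m a X) / (X + 2)) (at (x $ 2))"
    using DERIV_add[OF der(1) DERIV_cmult[OF der(2), of \<sigma>]] by (simp add: mult_ac)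
  have 2: "((\<lambda>r. \<sigma> * k r) has_real_derivative \<sigma> * (a * S / (\<kappa> * X))) (at (x $ 2))"
    using DERIV_cmult[OF der(3), of \<sigma>] by (simp add: mult_ac)
  have X: "X \<noteq> 0" "X + 2 \<noteq> 0" "\<sigma>^2 = 1"
    using \<sigma> by auto
  show ?thesis
    unfolding inverse_metric_block_matrix[OF X_def sin]
    by (intro exI conjI, rule has_derivative_shear_chart[OF 1 g 2], rule outgoing_congruence)
      (use S sin X \<kappa> Q in auto)
qed

text \<open>A shear with \<open>c = 1\<close> preserves the determinant, which explains the value.
  The direct computation also covers \<open>X = - 2\<close>, where the shear itself is
  singular.\<close>

lemma block_det_outgoing:
  fixes S X y \<kappa> \<sigma> \<theta> :: real
  assumes "S \<noteq> 0" "X \<noteq> 0" "sin \<theta> \<noteq> 0" "\<kappa> \<noteq> 0" "\<kappa>^2 = m^2 - a^2" "y^2 = Q_fun m a X"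
  shows "block_det (a^2 * (sin \<theta>)^2) (- X * y / S) (a * (X + 1) + a * y / \<kappa>)
      (X * (X + 2) / S^2) (- a * (X + 2) / (\<kappa> * S)) (1 / (sin \<theta>)^2 + a^2 * (X + 2) / (\<kappa>^2 * X))
    = X^2 * P_fun m a X \<theta> / (S^2 * (sin \<theta>)^2)"
proof -
  define s z where "s = (sin \<theta>)^2" and "z = y / \<kappa>"
  have s: "s \<noteq> 0" "(cos \<theta>)^2 = 1 - s"
    using assms(3) by (simp_all add: s_def cos_squared_eq)
  have y: "y = \<kappa> * z"
    using assms(4) by (simp add: z_def)
  have "block_det (a^2 * s) (- X * y / S) (a * (X + 1) + a * y / \<kappa>)
      (X * (X + 2) / S^2) (- a * (X + 2) / (\<kappa> * S)) (1 / s + a^2 * (X + 2) / (\<kappa>^2 * X))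
    = - (X^2 * (y^2 + a^2 * s * (X + 2)^2) / (S^2 * s))"
  proof -
    \<comment> \<open>Reciprocals become letters subject to polynomial relations, so that the
      identity can be decided by \<open>algebra\<close>.\<close>
    define e f h i where "e = 1 / s" and "f = 1 / \<kappa>" and "h = a^2 * (X + 2) / (\<kappa>^2 * X)" and "i = 1 / S"
    have "e * s = 1" "f * \<kappa> = 1" "h * X = a^2 * (X + 2) * f^2"
      using assms(2,4) s(1) by (simp_all add: e_def f_def h_def power_divide)
    then have "block_det (a^2 * s) (- X * (\<kappa> * z) * i) (a * (X + 1) + a * z)
      (X * (X + 2) * i^2) (- a * (X + 2) * (f * i)) (e + h) = - (X^2 * ((\<kappa> * z)^2 + a^2 * s * (X + 2)^2) * (i^2 * e))"
      unfolding block_det_def by algebra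
    then show ?thesis
      using assms(4) unfolding y e_def f_def h_def i_def by (simp add: power_divide)
  qed
  also have "y^2 + a^2 * s * (X + 2)^2 = - P_fun m a X \<theta>"
    unfolding assms(6) P_fun_def Q_fun_def s(2) by algebra
  finally show ?thesis
    by (simp add: s_def)
qed

section \<open>The past event horizon in outgoing coordinates\<close>

lemma smooth_past_horizon_gt:
  assumes "\<bar>a\<bar> < m" "S < 0" "outgoing_integrals m a S R Rt {r. Rt - 2 / S < r} rs w k"
  shows "smooth_past_horizon (gt m a S R Rt) (region_minus S Rt) (outgoing_chart 1 rs w k) (Rt - 2 / S)"
proof -
  define \<kappa> where "\<kappa> = sqrt (m^2 - a^2)"
  have "a^2 < m^2"
    using assms(1) by (rule sq_less_sq)
  then have \<kappa>: "0 < \<kappa>" "\<kappa>^2 = m^2 - a^2"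
    by (simp_all add: \<kappa>_def)
  define X where "X p = X_fun S Rt (p $ 2)" for p :: "real^4"
  \<comment> \<open>These open conditions make both square roots smooth and, by the last one,
    \<open>?\<zeta>\<close> positive. They hold for \<open>X \<le> - 2\<close>, so \<open>U\<close>
    contains a neighbourhood of the horizon.\<close>
  define U where "U = {p::real^4. 0 < p $ 3 \<and> p $ 3 < pi \<and> X p < 0 \<and> P_fun m a (X p) (p $ 3) < 0 \<and>
    0 < Q_fun m a (X p) \<and> \<kappa>^2 * X p + a^2 * (X p + 2) * (sin (p $ 3))^2 < 0}"
  have "open U"
    unfolding U_def X_def X_fun_def P_fun_def Q_fun_def
    by (intro open_Collect_conj open_Collect_less continuous_intros)
  have X_le: "X p < - 2 \<longleftrightarrow> Rt - 2 / S < p $ 2" "X p = - 2 \<longleftrightarrow> p $ 2 = Rt - 2 / S" for p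
    using assms(2) by (auto simp: X_def X_fun_def field_simps)
  have in_U: "p \<in> U" if "0 < p $ 3" "p $ 3 < pi" "X p \<le> - 2" for p
  proof -
    have "\<kappa>^2 * X p < 0" "a^2 * (X p + 2) \<le> 0"
      using that(3) \<kappa>(1) by (auto intro: mult_pos_neg mult_nonneg_nonpos)
    then have "\<kappa>^2 * X p + a^2 * (X p + 2) * (sin (p $ 3))^2 < 0"
      by (metis add_neg_nonpos mult_nonpos_nonneg zero_le_power2)
    then show ?thesis
      using that P_fun_neg[OF assms(1)] Q_fun_pos[OF assms(1)] by (auto simp: U_def)
  qed
  define \<Psi> where "\<Psi> = outgoing_chart 1 rs w k"
  have \<Psi>: "\<Psi> x $ 2 = x $ 2" "\<Psi> x $ 3 = x $ 3" "X (\<Psi> x) = X x" for x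
    by (simp_all add: \<Psi>_def outgoing_chart_def X_def)
  have M: "x \<in> region_minus S Rt \<longleftrightarrow> X x < - 2 \<and> 0 < x $ 3 \<and> x $ 3 < pi" for x
    by (simp add: region_minus_def X_def)
  have sin: "sin (p $ 3) \<noteq> 0" if "0 < p $ 3" "p $ 3 < pi" for p :: "real^4"
    using sin_gt_zero[OF that] by simp
  let ?\<alpha> = "\<lambda>p::real^4. a^2 * (sin (p $ 3))^2"
  let ?\<beta> = "\<lambda>p. - X p * sqrt (Q_fun m a (X p)) / S"
  let ?\<gamma> = "\<lambda>p. a * (X p + 1) + a * sqrt (Q_fun m a (X p)) / \<kappa>"
  let ?\<delta> = "\<lambda>p. X p * (X p + 2) / S^2"
  let ?\<eta> = "\<lambda>p. - a * (X p + 2) / (\<kappa> * S)"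
  let ?\<zeta> = "\<lambda>p. 1 / (sin (p $ 3))^2 + a^2 * (X p + 2) / (\<kappa>^2 * X p)"
  \<comment> \<open>This is \<open>qt_sq\<close> with its absolute values resolved by
    \<open>X < 0\<close>, \<open>S < 0\<close> and \<open>P_fun < 0\<close>.\<close>
  let ?\<Omega> = "\<lambda>p. X p / S * sqrt (- P_fun m a (X p) (p $ 3))"
  have sm_X: "smooth_on_open U X"
    unfolding X_def[abs_def] X_fun_def by (intro smooth_intros \<open>open U\<close>)
  have sm_Q: "smooth_on_open U (\<lambda>p. sqrt (Q_fun m a (X p)))"
    unfolding Q_fun_def by (intro smooth_intros \<open>open U\<close> sm_X) (auto simp: U_def Q_fun_def)
  have sm_P: "smooth_on_open U (\<lambda>p. sqrt (- P_fun m a (X p) (p $ 3)))"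
    unfolding P_fun_def by (intro smooth_intros \<open>open U\<close> sm_X) (auto simp: U_def P_fun_def)
  have smooth: "smooth_on_open U ?\<alpha>" "smooth_on_open U ?\<beta>" "smooth_on_open U ?\<gamma>" "smooth_on_open U ?\<delta>"
    "smooth_on_open U ?\<eta>" "smooth_on_open U ?\<zeta>" "smooth_on_open U ?\<Omega>"
    by (intro smooth_intros \<open>open U\<close> sm_X sm_Q sm_P; use assms(2) \<kappa>(1) sin in \<open>auto simp: U_def\<close>)+
  have pos: "0 < ?\<zeta> p" if "p \<in> U" for p
  proof -
    have "?\<zeta> p = (\<kappa>^2 * X p + a^2 * (X p + 2) * (sin (p $ 3))^2) / ((sin (p $ 3))^2 * (\<kappa>^2 * X p))"
      using that \<kappa>(1) sin[of p] by (simp add: U_def field_simps)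
    moreover have "(sin (p $ 3))^2 * (\<kappa>^2 * X p) < 0"
      using that \<kappa>(1) sin[of p] by (simp add: U_def mult_pos_neg)
    ultimately show ?thesis
      using that by (simp add: U_def divide_neg_neg)
  qed
  have det: "block_det (?\<alpha> p) (?\<beta> p) (?\<gamma> p) (?\<delta> p) (?\<eta> p) (?\<zeta> p) < 0" if "p \<in> U" for p
  proof -
    have "X p \<noteq> 0" "sin (p $ 3) \<noteq> 0" "0 < Q_fun m a (X p)" "P_fun m a (X p) (p $ 3) < 0"
      using that sin[of p] by (auto simp: U_def)
    then show ?thesis
      using assms(2) \<kappa> by (subst block_det_outgoing) (auto simp: divide_neg_pos mult_pos_neg)
  qed
  have timelike: "?\<eta> p ^ 2 < ?\<delta> p * ?\<zeta> p" if "p \<in> \<Psi> ` region_minus S Rt" for p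
  proof -
    have p: "X p < - 2" "sin (p $ 3) \<noteq> 0"
      using that \<Psi> sin by (auto simp: M)
    \<comment> \<open>The second summand of \<open>?\<zeta>\<close>, multiplied by
      \<open>?\<delta>\<close>, is exactly \<open>?\<eta>^2\<close>.\<close>
    then have "?\<delta> p * ?\<zeta> p = X p * (X p + 2) / (S^2 * (sin (p $ 3))^2) + ?\<eta> p ^ 2"
      using assms(2) \<kappa>(1) by (simp add: field_simps power2_eq_square)
    moreover have "0 < X p * (X p + 2)"
      using p(1) by (intro mult_neg_neg) auto
    then have "0 < X p * (X p + 2) / (S^2 * (sin (p $ 3))^2)"
      using p(2) assms(2) by simp
    ultimately show ?thesis
      by linarith
  qed
  have cover: "\<exists>\<epsilon>>0. {p. Rt - 2 / S < p $ 2 \<and> p $ 2 < Rt - 2 / S + \<epsilon> \<and> 0 < p $ 3 \<and> p $ 3 < pi}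
      \<subseteq> \<Psi> ` region_minus S Rt"
    unfolding \<Psi>_def outgoing_chart_eq
    by (intro exI[of _ 1] conjI subsetI shear_chart_image[of _ "_ $ 2"]) (auto simp: M X_le)
  have jac: "\<exists>J. (\<Psi> has_derivative (*v) J) (at x) \<and> J ** (h_inv m a S R Rt x + O_inv a x) ** transpose J
      = block_matrix (?\<alpha> (\<Psi> x)) (?\<beta> (\<Psi> x)) (?\<gamma> (\<Psi> x)) (?\<delta> (\<Psi> x)) (?\<eta> (\<Psi> x)) (?\<zeta> (\<Psi> x)) 1"
    if "x \<in> region_minus S Rt" for x
  proof -
    have "X x < - 2" "sin (x $ 3) \<noteq> 0" "x $ 2 \<in> {r. Rt - 2 / S < r}"
      using that sin by (auto simp: M X_le)
    then show ?thesis
      using outgoing_chart_jacobian[OF _ \<kappa>_def assms, of "X x" x 1 "\<lambda>r. r" 1] Q_fun_pos[OF assms(1), of "X x"]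
      unfolding \<Psi> unfolding \<Psi>_def outgoing_chart_eq by (simp add: X_def)
  qed
  have bd: "X p = - 2" "0 < p $ 3" "p $ 3 < pi" if "p \<in> level_set (Rt - 2 / S)" for p
    using that X_le(2) by (auto simp: level_set_def)
  have sub: "\<Psi> ` region_minus S Rt \<union> level_set (Rt - 2 / S) \<subseteq> U"
    using in_U \<Psi> bd by (auto simp: M)
  have inj: "inj_on \<Psi> (region_minus S Rt)"
    unfolding \<Psi>_def outgoing_chart_eq by (intro inj_on_shear_chart) simp
  have pos_\<Omega>: "0 < ?\<Omega> p" if "p \<in> U" for p
    using that assms(2) by (simp add: U_def divide_neg_neg mult_neg_pos)
  have q: "qt_sq m a S Rt x \<noteq> 0" "?\<Omega> (\<Psi> x) = 1 * qt_sq m a S Rt x" if "x \<in> region_minus S Rt" for x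
  proof -
    have "P_fun m a (X x) (x $ 3) < 0" "X x < 0"
      using that P_fun_neg[OF assms(1)] by (auto simp: M)
    then show "qt_sq m a S Rt x \<noteq> 0" "?\<Omega> (\<Psi> x) = 1 * qt_sq m a S Rt x"
      unfolding \<Psi> using assms(2) by (auto simp: qt_sq_def X_def Let_def abs_of_neg)
  qed
  have bd_zero: "?\<delta> p = 0" "?\<eta> p = 0" if "p \<in> level_set (Rt - 2 / S)" for p
    using bd[OF that] by auto
  note main = null_boundaryI[OF \<open>open U\<close> sub smooth pos_\<Omega> pos det inj cover gt_def q jac timelike bd_zero]
  show ?thesis
    unfolding smooth_past_horizon_def \<Psi>_def[symmetric]
  proof (intro exI conjI ballI allI impI)
    show "smooth_null_boundary (gt m a S R Rt) (\<lambda>x. 1) (region_minus S Rt) \<Psi> (Rt - 2 / S) U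
      (\<lambda>p. ?\<Omega> p *\<^sub>R block_inverse (?\<alpha> p) (?\<beta> p) (?\<gamma> p) (?\<delta> p) (?\<eta> p) (?\<zeta> p) 1)"
      by (rule main(1)) assumption+
    fix p W assume p: "p \<in> level_set (Rt - 2 / S)" and W: "future_timelike
      (\<lambda>p. ?\<Omega> p *\<^sub>R block_inverse (?\<alpha> p) (?\<beta> p) (?\<gamma> p) (?\<delta> p) (?\<eta> p) (?\<zeta> p) 1) p W"
    have "?\<beta> p * W $ 2 < 0"
      by (rule main(2)) (assumption | rule p W)+
    \<comment> \<open>At \<open>X = - 2\<close> this entry is \<open>2 * sqrt Q / S\<close>. Its
      negative sign means that \<open>r\<close> increases to the future, towards
      \<open>X < - 2\<close>.\<close>
    moreover have "?\<beta> p < 0"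
      using bd(1)[OF p] assms(1,2) Q_fun_pos[OF assms(1), of "X p"] by (auto simp: divide_pos_neg)
    ultimately show "0 < W $ 2"
      by (metis less_asym mult_less_0_iff)
  qed
qed

section \<open>Null infinity\<close>

text \<open>With \<open>X = - 1 - \<sigma> / \<rho>\<close>, these are \<open>\<rho>\<^sup>2 Q\<close> and \<open>- \<rho>\<^sup>2 P\<close>, continued to \<open>\<rho> \<le> 0\<close>.\<close>

definition Q_resc :: "real \<Rightarrow> real \<Rightarrow> real \<Rightarrow> real \<Rightarrow> real" where
  "Q_resc m a \<sigma> \<rho> = (m^2 - a^2) * (1 + \<sigma> * \<rho>)^2 + 4 * a^2 * \<sigma> * \<rho>"

definition P_resc :: "real \<Rightarrow> real \<Rightarrow> real \<Rightarrow> real \<Rightarrow> real \<Rightarrow> real" where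
  "P_resc m a \<sigma> \<rho> \<theta> = (m^2 - a^2 * (cos \<theta>)^2) * (1 + \<sigma> * \<rho>)^2 + 4 * a^2 * (cos \<theta>)^2 * \<sigma> * \<rho>"

text \<open>The substitution for \<open>X\<close> is written without division, which makes both
  claims polynomial identities.\<close>

lemma rescaled_eq:
  assumes "\<rho> * X = - (\<rho> + \<sigma>)" "\<sigma>^2 = 1"
  shows "\<rho>^2 * Q_fun m a X = Q_resc m a \<sigma> \<rho>" "- (\<rho>^2 * P_fun m a X \<theta>) = P_resc m a \<sigma> \<rho> \<theta>"
  using assms unfolding Q_fun_def P_fun_def Q_resc_def P_resc_def by algebra+

text \<open>The \<open>u\<phi>\<close> component \<open>a (X + 1) + \<sigma> a \<surd>Q / \<kappa>\<close> is a difference of two terms of order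
  \<open>1 / \<rho>\<close>; rationalizing it shows that it is smooth at \<open>\<rho> = 0\<close>.\<close>

definition compactified_uphi :: "real \<Rightarrow> real \<Rightarrow> real \<Rightarrow> real \<Rightarrow> real" where
  "compactified_uphi m a \<sigma> \<rho> = (let \<kappa> = sqrt (m^2 - a^2) in
     \<sigma> * a * (2 * \<sigma> + \<rho> + 4 * a^2 * \<sigma> / \<kappa>^2) / (sqrt (Q_resc m a \<sigma> \<rho>) / \<kappa> + 1))"

text \<open>For \<open>z = sqrt (Q_resc m a \<sigma> \<rho>) / \<kappa>\<close> the difference
  \<open>z^2 - 1\<close> is divisible by \<rho>; cancelling \<open>z + 1 > 0\<close> gives the
  claim, also at \<open>\<rho> = 0\<close>.\<close>

lemma compactified_uphi:
  assumes "0 < \<kappa>" "\<kappa> = sqrt (m^2 - a^2)" "0 < Q_resc m a \<sigma> \<rho>" "\<sigma>^2 = 1"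
  shows "\<rho> * compactified_uphi m a \<sigma> \<rho> = \<sigma> * a * (sqrt (Q_resc m a \<sigma> \<rho>) / \<kappa> - 1)"
proof -
  define z where "z = sqrt (Q_resc m a \<sigma> \<rho>) / \<kappa>"
  have z: "0 < z + 1"
    using assms(1,3) by (simp add: z_def add_pos_pos)
  have \<kappa>: "\<kappa>^2 = m^2 - a^2" "\<kappa> \<noteq> 0"
    using assms(1,2) by auto
  have "z^2 = Q_resc m a \<sigma> \<rho> / \<kappa>^2"
    using assms(3) by (simp add: z_def power_divide)
  also have "\<dots> = 1 + \<rho> * (2 * \<sigma> + \<rho> + 4 * a^2 * \<sigma> / \<kappa>^2)"
    using \<kappa>(2) assms(4) unfolding Q_resc_def \<kappa>(1)[symmetric] by (simp add: field_simps power2_eq_square)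
  finally have "\<rho> * (2 * \<sigma> + \<rho> + 4 * a^2 * \<sigma> / \<kappa>^2) = (z - 1) * (z + 1)"
    by (simp add: algebra_simps power2_eq_square)
  then have "\<rho> * (\<sigma> * a * (2 * \<sigma> + \<rho> + 4 * a^2 * \<sigma> / \<kappa>^2)) = \<sigma> * a * (z - 1) * (z + 1)"
    by algebra
  then show ?thesis
    using z unfolding compactified_uphi_def Let_def assms(2)[symmetric] z_def[symmetric]
    by (simp add: field_simps)
qed

text \<open>The \<open>u\<phi>\<close> entry \<open>g\<close> enters the determinant only through
  \<open>\<rho> * g\<close>, which is known from \<open>compactified_uphi\<close>. Hence the
  computation never divides by \<rho> and is valid on the boundary.\<close>

lemma block_det_compactified:
  fixes \<sigma> \<rho> \<theta> \<kappa> :: real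
  assumes "0 < \<kappa>" "\<kappa> = sqrt (m^2 - a^2)" "0 < Q_resc m a \<sigma> \<rho>" "\<sigma>^2 = 1" "sin \<theta> \<noteq> 0" "1 + \<sigma> * \<rho> \<noteq> 0"
  shows "block_det (a^2 * (sin \<theta>)^2) ((1 + \<sigma> * \<rho>) * sqrt (Q_resc m a \<sigma> \<rho>)) (compactified_uphi m a \<sigma> \<rho>)
      (\<rho>^2 * (1 - \<rho>^2)) (\<rho> * a * (\<sigma> - \<rho>) / \<kappa>)
      (1 / (sin \<theta>)^2 + a^2 * (1 - \<sigma> * \<rho>) / (\<kappa>^2 * (1 + \<sigma> * \<rho>)))
    = - ((1 + \<sigma> * \<rho>)^2 * P_resc m a \<sigma> \<rho> \<theta> / (sin \<theta>)^2)"
proof -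
  define s e f z g h where "s = (sin \<theta>)^2" and "e = 1 / s" and "f = 1 / \<kappa>"
    and "z = sqrt (Q_resc m a \<sigma> \<rho>) / \<kappa>" and "g = compactified_uphi m a \<sigma> \<rho>"
    and "h = a^2 * (1 - \<sigma> * \<rho>) / (\<kappa>^2 * (1 + \<sigma> * \<rho>))"
  have \<kappa>: "\<kappa>^2 = m^2 - a^2" "\<kappa> \<noteq> 0"
    using assms(1,2) by auto
  have c: "(cos \<theta>)^2 = 1 - s"
    by (simp add: s_def cos_squared_eq)
  have r: "sqrt (Q_resc m a \<sigma> \<rho>) = \<kappa> * z"
    using \<kappa>(2) by (simp add: z_def)
  have "(\<kappa> * z)^2 = Q_resc m a \<sigma> \<rho>"
    using assms(3) by (simp add: r[symmetric])
  then have P: "(\<kappa> * z)^2 + a^2 * s * (1 - \<sigma> * \<rho>)^2 = P_resc m a \<sigma> \<rho> \<theta>"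
    unfolding P_resc_def Q_resc_def c by algebra
  have rel: "e * s = 1" "f * \<kappa> = 1" "h * (1 + \<sigma> * \<rho>) = a^2 * (1 - \<sigma> * \<rho>) * f^2"
    "\<rho> * g = \<sigma> * a * (z - 1)"
    using assms(5,6) \<kappa>(2) compactified_uphi[OF assms(1-4)]
    by (simp_all add: e_def f_def h_def s_def g_def z_def power_divide)
  have "block_det (a^2 * s) ((1 + \<sigma> * \<rho>) * (\<kappa> * z)) g (\<rho>^2 * (1 - \<rho>^2)) (\<rho> * a * (\<sigma> - \<rho>) * f) (e + h)
    = - ((1 + \<sigma> * \<rho>)^2 * ((\<kappa> * z)^2 + a^2 * s * (1 - \<sigma> * \<rho>)^2) * e)"
  proof -
    \<comment> \<open>The terms of the determinant are evaluated separately. In their sum all terms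
      in \<open>z\<close> cancel except
      \<open>- e * ((1 + \<sigma> * \<rho>) * (\<kappa> * z))^2\<close>, and the remaining ones add
      up to \<open>- a^2 * (1 - \<rho>^2)^2\<close>.\<close>
    have 1: "\<rho>^2 * (1 - \<rho>^2) = \<rho>^2 * ((1 + \<sigma> * \<rho>) * (1 - \<sigma> * \<rho>))"
      using assms(4) by algebra
    have 2: "a^2 * s * (\<rho>^2 * (1 - \<rho>^2)) * (e + h) - a^2 * s * (\<rho> * a * (\<sigma> - \<rho>) * f)^2 = a^2 * \<rho>^2 * (1 - \<rho>^2)"
      using rel(1,3) assms(4) unfolding 1 by algebra
    have 3: "\<rho>^2 * (1 - \<rho>^2) * g^2 = (1 - \<rho>^2) * (a * (z - 1))^2"
      using rel(4) assms(4) by algebra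
    have 4: "2 * ((1 + \<sigma> * \<rho>) * (\<kappa> * z)) * g * (\<rho> * a * (\<sigma> - \<rho>) * f) = 2 * (1 - \<rho>^2) * a^2 * z * (z - 1)"
      using rel(2,4) assms(4) by algebra
    have 5: "(e + h) * ((1 + \<sigma> * \<rho>) * (\<kappa> * z))^2 = e * ((1 + \<sigma> * \<rho>) * (\<kappa> * z))^2 + (1 - \<rho>^2) * a^2 * z^2"
      using rel(2,3) assms(4) by algebra
    have 6: "(1 + \<sigma> * \<rho>)^2 * (a^2 * s * (1 - \<sigma> * \<rho>)^2) * e = a^2 * (1 - \<rho>^2)^2"
      using rel(1) assms(4) by algebra
    show ?thesis
      unfolding block_det_def using 2 3 4 5 6 by algebra
  qed
  then show ?thesis
    unfolding P by (simp add: r s_def[symmetric] g_def[symmetric] h_def[symmetric] e_def f_def)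
qed

text \<open>Rewrites the entries found in \<open>outgoing_chart_jacobian\<close> in forms regular at
  \<open>\<rho> = 0\<close>; \<open>c\<close> is the derivative of
  \<open>\<rho> = - \<sigma> / (X + 1)\<close> in \<open>r\<close>.\<close>

lemma compactified_components:
  fixes \<rho> X \<sigma> S \<kappa> :: real
  assumes "0 < \<rho>" "\<rho> < 1" "\<rho> * X = - (\<rho> + \<sigma>)" "\<sigma> = 1 \<or> \<sigma> = - 1" "0 < \<kappa>" "\<kappa> = sqrt (m^2 - a^2)"
    "0 < Q_fun m a X" "S \<noteq> 0"
  defines "c \<equiv> \<sigma> * S * \<rho>^2"
  shows "c * (- X * sqrt (Q_fun m a X) / S) = (1 + \<sigma> * \<rho>) * sqrt (Q_resc m a \<sigma> \<rho>)"
    "a * (X + 1) + \<sigma> * a * sqrt (Q_fun m a X) / \<kappa> = compactified_uphi m a \<sigma> \<rho>"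
    "c^2 * (X * (X + 2) / S^2) = \<rho>^2 * (1 - \<rho>^2)"
    "c * (- \<sigma> * a * (X + 2) / (\<kappa> * S)) = \<rho> * a * (\<sigma> - \<rho>) / \<kappa>"
    "a^2 * (X + 2) / (\<kappa>^2 * X) = a^2 * (1 - \<sigma> * \<rho>) / (\<kappa>^2 * (1 + \<sigma> * \<rho>))"
proof -
  define y where "y = sqrt (Q_fun m a X)"
  have \<sigma>: "\<sigma>^2 = 1"
    using assms(4) by auto
  note resc = rescaled_eq(1)[OF assms(3) \<sigma>, of m a]
  have y: "sqrt (Q_resc m a \<sigma> \<rho>) = \<rho> * y"
    using assms(1) by (simp add: resc[symmetric] y_def real_sqrt_mult)
  have X: "X \<noteq> 0" "1 + \<sigma> * \<rho> \<noteq> 0"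
    using assms(1-4) by auto
  have "c * (- X * y / S) = - \<sigma> * \<rho> * y * (\<rho> * X)"
    using assms(8) by (simp add: c_def power2_eq_square)
  also have "\<dots> = (1 + \<sigma> * \<rho>) * (\<rho> * y)"
    using assms(3) \<sigma> by algebra
  finally show "c * (- X * sqrt (Q_fun m a X) / S) = (1 + \<sigma> * \<rho>) * sqrt (Q_resc m a \<sigma> \<rho>)"
    by (simp add: y y_def)
  have "0 < Q_resc m a \<sigma> \<rho>"
    using assms(1,7) by (simp add: resc[symmetric])
  then have "\<rho> * compactified_uphi m a \<sigma> \<rho> = \<sigma> * a * (\<rho> * y / \<kappa> - 1)"
    using compactified_uphi[OF assms(5,6) _ \<sigma>, of \<rho>] y by simp
  also have "\<dots> = \<rho> * (a * (X + 1) + \<sigma> * a * y / \<kappa>)"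
  proof -
    have "\<rho> * (a * (X + 1)) = - (\<sigma> * a)"
      using assms(3) by algebra
    then show ?thesis
      by (simp add: algebra_simps)
  qed
  finally show "a * (X + 1) + \<sigma> * a * sqrt (Q_fun m a X) / \<kappa> = compactified_uphi m a \<sigma> \<rho>"
    using assms(1) by (simp add: y_def)
  have "c^2 * (X * (X + 2) / S^2) = (\<rho>^2)^2 * (X * (X + 2))"
    using assms(8) \<sigma> by (simp add: c_def power_mult_distrib)
  also have "\<dots> = \<rho>^2 * (1 - \<rho>^2)"
    using assms(3) \<sigma> by algebra
  finally show "c^2 * (X * (X + 2) / S^2) = \<rho>^2 * (1 - \<rho>^2)" .
  have "c * (- \<sigma> * a * (X + 2) / (\<kappa> * S)) = - (\<sigma>^2 * \<rho> * a * (\<rho> * X + 2 * \<rho>)) / \<kappa>"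
    using assms(5,8) by (simp add: c_def field_simps power2_eq_square)
  also have "\<dots> = \<rho> * a * (\<sigma> - \<rho>) / \<kappa>"
    unfolding assms(3) \<sigma> by (simp add: algebra_simps)
  finally show "c * (- \<sigma> * a * (X + 2) / (\<kappa> * S)) = \<rho> * a * (\<sigma> - \<rho>) / \<kappa>" .
  have "\<rho> * ((X + 2) * (1 + \<sigma> * \<rho>)) = \<rho> * ((1 - \<sigma> * \<rho>) * X)"
    using assms(3) \<sigma> by algebra
  then have "(X + 2) * (1 + \<sigma> * \<rho>) = (1 - \<sigma> * \<rho>) * X"
    using assms(1) by simp
  then have "(X + 2) / X = (1 - \<sigma> * \<rho>) / (1 + \<sigma> * \<rho>)"
    using X by (simp add: frac_eq_eq)
  then show "a^2 * (X + 2) / (\<kappa>^2 * X) = a^2 * (1 - \<sigma> * \<rho>) / (\<kappa>^2 * (1 + \<sigma> * \<rho>))"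
    by (metis times_divide_times_eq)
qed

text \<open>Treats both ends at once. The hypotheses on \<open>\<sigma> * (X + 1)\<close> say that
  \<open>\<rho> < 1\<close> on \<open>M\<close> and that \<open>M\<close> contains all points with
  \<open>\<rho> < \<epsilon>\<close> at the end selected by \<sigma>.\<close>

lemma null_infinity_gt:
  assumes a: "\<bar>a\<bar> < m" and S: "S < 0" and int: "outgoing_integrals m a S R Rt I rs w k"
    and \<sigma>: "\<sigma> = 1 \<or> \<sigma> = - 1"
    and M: "\<And>x. x \<in> M \<Longrightarrow> x $ 2 \<in> I \<and> 0 < x $ 3 \<and> x $ 3 < pi \<and> \<sigma> * (X_fun S Rt (x $ 2) + 1) < - 1 \<and>
      P_fun m a (X_fun S Rt (x $ 2)) (x $ 3) < 0 \<and> 0 < Q_fun m a (X_fun S Rt (x $ 2))"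
    and \<epsilon>: "0 < \<epsilon>" "\<And>x. 0 < x $ 3 \<Longrightarrow> x $ 3 < pi \<Longrightarrow> \<sigma> * (X_fun S Rt (x $ 2) + 1) < - (1 / \<epsilon>) \<Longrightarrow> x \<in> M"
  shows "asymptotically_flat_future_null_infinity (gt m a S R Rt) M (compactified_chart S Rt \<sigma> rs w k)"
proof -
  define \<kappa> where "\<kappa> = sqrt (m^2 - a^2)"
  have "a^2 < m^2"
    using a by (rule sq_less_sq)
  then have \<kappa>: "0 < \<kappa>" "\<kappa>^2 = m^2 - a^2"
    by (simp_all add: \<kappa>_def)
  have \<sigma>2: "\<sigma>^2 = 1" "\<sigma> \<noteq> 0"
    using \<sigma> by auto
  define X where "X x = X_fun S Rt (x $ 2)" for x :: "real^4"
  define \<Psi> where "\<Psi> = compactified_chart S Rt \<sigma> rs w k"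
  have \<Psi>: "\<Psi> x $ 2 = 1 / \<bar>X x + 1\<bar>" "\<Psi> x $ 3 = x $ 3" for x
    by (simp_all add: \<Psi>_def compactified_chart_def outgoing_chart_def X_def Let_def)
  define \<rho> where "\<rho> x = \<Psi> x $ 2" for x
  have MX: "x $ 2 \<in> I" "sin (x $ 3) \<noteq> 0" "\<sigma> * (X x + 1) < - 1" "P_fun m a (X x) (x $ 3) < 0" "0 < Q_fun m a (X x)"
    "\<sigma> = 1 \<and> X x < - 2 \<or> \<sigma> = - 1 \<and> 0 < X x"
    if "x \<in> M" for x
    using M[OF that] sin_gt_zero[of "x $ 3"] \<sigma> by (auto simp: X_def)
  have \<rho>: "0 < \<rho> x" "\<rho> x < 1" "\<rho> x * X x = - (\<rho> x + \<sigma>)" "\<rho> x = - \<sigma> / (X x + 1)" if "x \<in> M" for x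
    using MX(6)[OF that] by (auto simp: \<rho>_def \<Psi> abs_if field_simps)
  \<comment> \<open>The range \<open>\<bar>\<rho>\<bar> < 1\<close> keeps
    \<open>1 + \<sigma> * \<rho>\<close> and \<open>1 - \<sigma> * \<rho>\<close> positive and
    extends past the boundary to negative \<rho>.\<close>
  define U where "U = {p::real^4. 0 < p $ 3 \<and> p $ 3 < pi \<and> - 1 < p $ 2 \<and> p $ 2 < 1 \<and>
    0 < Q_resc m a \<sigma> (p $ 2) \<and> 0 < P_resc m a \<sigma> (p $ 2) (p $ 3)}"
  have "open U"
    unfolding U_def Q_resc_def P_resc_def
    by (intro open_Collect_conj open_Collect_less continuous_intros)
  have resc: "Q_resc m a \<sigma> (\<rho> x) = (\<rho> x)^2 * Q_fun m a (X x)"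
    "P_resc m a \<sigma> (\<rho> x) (x $ 3) = - ((\<rho> x)^2 * P_fun m a (X x) (x $ 3))" if "x \<in> M" for x
    using rescaled_eq[OF \<rho>(3)[OF that] \<sigma>2(1)] by simp_all
  have bd: "p $ 2 = 0" "0 < p $ 3" "p $ 3 < pi" if "p \<in> level_set 0" for p
    using that by (auto simp: level_set_def)
  have sub: "\<Psi> ` M \<union> level_set 0 \<subseteq> U"
  proof -
    have "a^2 * (cos t)^2 < m^2" for t
      using \<open>a^2 < m^2\<close> by (metis abs_cos_le_one abs_square_le_1 le_less_trans mult_left_le zero_le_power2)
    then have "level_set 0 \<subseteq> U"
      using bd \<open>a^2 < m^2\<close> by (auto simp: U_def Q_resc_def P_resc_def)
    moreover have "\<Psi> x \<in> U" if "x \<in> M" for x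
      using M[OF that] \<rho>[OF that] MX[OF that] resc[OF that]
      by (auto simp: U_def \<rho>_def[symmetric] \<Psi>(2) mult_pos_neg)
    ultimately show ?thesis
      by auto
  qed
  have U: "sin (p $ 3) \<noteq> 0" "0 < 1 + \<sigma> * p $ 2" "0 < 1 - \<sigma> * p $ 2"
    "0 < Q_resc m a \<sigma> (p $ 2)" "0 < P_resc m a \<sigma> (p $ 2) (p $ 3)" if "p \<in> U" for p
    using that \<sigma> sin_gt_zero[of "p $ 3"] by (auto simp: U_def)
  let ?\<alpha> = "\<lambda>p::real^4. a^2 * (sin (p $ 3))^2"
  let ?\<beta> = "\<lambda>p::real^4. (1 + \<sigma> * p $ 2) * sqrt (Q_resc m a \<sigma> (p $ 2))"
  let ?\<gamma> = "\<lambda>p::real^4. compactified_uphi m a \<sigma> (p $ 2)"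
  let ?\<delta> = "\<lambda>p::real^4. (p $ 2)^2 * (1 - (p $ 2)^2)"
  let ?\<eta> = "\<lambda>p::real^4. p $ 2 * a * (\<sigma> - p $ 2) / \<kappa>"
  let ?\<zeta> = "\<lambda>p::real^4. 1 / (sin (p $ 3))^2 + a^2 * (1 - \<sigma> * p $ 2) / (\<kappa>^2 * (1 + \<sigma> * p $ 2))"
  \<comment> \<open>The continuation of \<open>\<rho>^2 * qt_sq\<close>: one factor \<rho> is
    absorbed by \<open>\<rho> * \<bar>X\<bar> = 1 + \<sigma> * \<rho>\<close>, the other by the
    square root of \<open>- P_fun\<close>.\<close>
  let ?\<Omega> = "\<lambda>p::real^4. (1 + \<sigma> * p $ 2) / \<bar>S\<bar> * sqrt (P_resc m a \<sigma> (p $ 2) (p $ 3))"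
  have sm_Q: "smooth_on_open U (\<lambda>p. sqrt (Q_resc m a \<sigma> (p $ 2)))"
    unfolding Q_resc_def by (intro smooth_intros \<open>open U\<close>) (use U(4) in \<open>auto simp: Q_resc_def\<close>)
  have sm_P: "smooth_on_open U (\<lambda>p. sqrt (P_resc m a \<sigma> (p $ 2) (p $ 3)))"
    unfolding P_resc_def by (intro smooth_intros \<open>open U\<close>) (use U(5) in \<open>auto simp: P_resc_def\<close>)
  have "sqrt (Q_resc m a \<sigma> (p $ 2)) / \<kappa> + 1 \<noteq> 0" if "p \<in> U" for p
    using U(4)[OF that] \<kappa>(1) by (metis add_pos_pos divide_pos_pos less_irrefl real_sqrt_gt_zero zero_less_one)
  then have sm_uphi: "smooth_on_open U ?\<gamma>"
    unfolding compactified_uphi_def Let_def \<kappa>_def[symmetric]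
    by (intro smooth_intros \<open>open U\<close> sm_Q) (use \<kappa>(1) in auto)
  have nz: "sin (p $ 3) \<noteq> 0" "1 + \<sigma> * p $ 2 \<noteq> 0" "\<kappa> \<noteq> 0" "S \<noteq> 0" if "p \<in> U" for p
    using U(1,2)[OF that] \<kappa>(1) S by auto
  have smooth: "smooth_on_open U ?\<alpha>" "smooth_on_open U ?\<beta>" "smooth_on_open U ?\<gamma>" "smooth_on_open U ?\<delta>"
    "smooth_on_open U ?\<eta>" "smooth_on_open U ?\<zeta>" "smooth_on_open U ?\<Omega>"
    by (intro smooth_intros \<open>open U\<close> sm_Q sm_P sm_uphi; simp add: nz)+
  have pos_\<Omega>: "0 < ?\<Omega> p" if "p \<in> U" for p
    using U[OF that] S by (intro mult_pos_pos divide_pos_pos) auto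
  have pos: "0 < ?\<zeta> p" if "p \<in> U" for p
    using U[OF that] \<kappa>(1) by (intro add_pos_nonneg divide_nonneg_nonneg mult_nonneg_nonneg) auto
  have det: "block_det (?\<alpha> p) (?\<beta> p) (?\<gamma> p) (?\<delta> p) (?\<eta> p) (?\<zeta> p) < 0" if "p \<in> U" for p
    using U[OF that] by (subst block_det_compactified[OF \<kappa>(1) \<kappa>_def _ \<sigma>2(1)]) auto
  have inj: "inj_on \<Psi> M"
    unfolding \<Psi>_def compactified_chart_eq
  proof (intro inj_on_shear_chart inj_onI, clarsimp)
    fix x y assume xy: "x \<in> M" "y \<in> M" "\<bar>X_fun S Rt (x $ 2) + 1\<bar> = \<bar>X_fun S Rt (y $ 2) + 1\<bar>"
    then have "X x = X y"
      using MX(6)[of x] MX(6)[of y] by (auto simp: X_def abs_if split: if_splits)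
    then show "x $ 2 = y $ 2"
      using S by (simp add: X_def X_fun_def)
  qed
  have cover: "\<exists>\<epsilon>>0. {p. 0 < p $ 2 \<and> p $ 2 < 0 + \<epsilon> \<and> 0 < p $ 3 \<and> p $ 3 < pi} \<subseteq> \<Psi> ` M"
  proof (intro exI[of _ \<epsilon>] conjI subsetI \<epsilon>(1))
    fix p :: "real^4" assume "p \<in> {p. 0 < p $ 2 \<and> p $ 2 < 0 + \<epsilon> \<and> 0 < p $ 3 \<and> p $ 3 < pi}"
    then have p: "0 < p $ 2" "1 / \<epsilon> < 1 / p $ 2" "0 < p $ 3" "p $ 3 < pi"
      using \<epsilon>(1) by (auto simp: frac_less2)
    \<comment> \<open>The radius at which \<open>X = - 1 - \<sigma> / \<rho>\<close>.\<close>
    define r where "r = Rt + (- 1 - \<sigma> / p $ 2) / S"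
    have r: "X_fun S Rt r + 1 = - \<sigma> / p $ 2"
      using S by (simp add: r_def X_fun_def)
    then have "\<sigma> * (X_fun S Rt r + 1) = - (1 / p $ 2)"
      using \<sigma>2(1) by (simp add: power2_eq_square)
    moreover have "1 / \<bar>X_fun S Rt r + 1\<bar> = p $ 2"
      unfolding r using \<sigma> p(1) by auto
    ultimately show "p \<in> \<Psi> ` M"
      unfolding \<Psi>_def compactified_chart_eq using p by (intro shear_chart_image[of _ r] \<epsilon>(2)) auto
  qed
  have q: "qt_sq m a S Rt x \<noteq> 0" "?\<Omega> (\<Psi> x) = (\<Psi> x $ 2)^2 * qt_sq m a S Rt x" if "x \<in> M" for x
  proof -
    note * = MX[OF that] \<rho>[OF that]
    have "X x \<noteq> 0"
      using *(6) by auto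
    then show "qt_sq m a S Rt x \<noteq> 0"
      using * S by (auto simp: qt_sq_def X_def Let_def)
    have "1 + \<sigma> * \<rho> x = \<rho> x * \<bar>X x\<bar>"
      using *(6,9) by auto
    then have "?\<Omega> (\<Psi> x) = \<rho> x * \<bar>X x\<bar> / \<bar>S\<bar> * sqrt ((\<rho> x)^2 * \<bar>P_fun m a (X x) (x $ 3)\<bar>)"
      using *(4) resc(2)[OF that] unfolding \<Psi>(2) \<rho>_def[symmetric] by (simp add: abs_of_neg)
    also have "\<dots> = (\<Psi> x $ 2)^2 * qt_sq m a S Rt x"
      using *(7) unfolding \<rho>_def[symmetric]
      by (simp add: qt_sq_def X_def[symmetric] Let_def real_sqrt_mult power2_eq_square)
    finally show "?\<Omega> (\<Psi> x) = (\<Psi> x $ 2)^2 * qt_sq m a S Rt x" .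
  qed
  have jac: "\<exists>J. (\<Psi> has_derivative (*v) J) (at x) \<and> J ** (h_inv m a S R Rt x + O_inv a x) ** transpose J
      = block_matrix (?\<alpha> (\<Psi> x)) (?\<beta> (\<Psi> x)) (?\<gamma> (\<Psi> x)) (?\<delta> (\<Psi> x)) (?\<eta> (\<Psi> x)) (?\<zeta> (\<Psi> x)) 1"
    if x: "x \<in> M" for x
  proof -
    \<comment> \<open>Near the point \<open>\<bar>X + 1\<bar>\<close> equals
      \<open>- \<sigma> * (X + 1)\<close>, so the derivative is that of a rational function.\<close>
    have "((\<lambda>r. 1 / \<bar>X_fun S Rt r + 1\<bar>) has_real_derivative \<sigma> * S * (\<rho> x)^2) (at (x $ 2))"
    proof (rule has_field_derivative_transform_within_open)
      have "X x + 1 \<noteq> 0"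
        using MX(6)[OF x] by auto
      then show "((\<lambda>r. - \<sigma> / (S * (r - Rt) + 1)) has_real_derivative \<sigma> * S * (\<rho> x)^2) (at (x $ 2))"
        using \<sigma>2(1) unfolding \<rho>(4)[OF x] X_def X_fun_def
        by (auto intro!: derivative_eq_intros simp: power_divide power2_eq_square)
      show "open {r. \<sigma> * (X_fun S Rt r + 1) < 0}"
        unfolding X_fun_def by (intro open_Collect_less continuous_intros)
      show "x $ 2 \<in> {r. \<sigma> * (X_fun S Rt r + 1) < 0}"
        using MX(3)[OF x] by (simp add: X_def)
      show "- \<sigma> / (S * (r - Rt) + 1) = 1 / \<bar>X_fun S Rt r + 1\<bar>" if "r \<in> {r. \<sigma> * (X_fun S Rt r + 1) < 0}" for r
        using that \<sigma> by (auto simp: X_fun_def abs_if divide_simps)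
    qed
    from outgoing_chart_jacobian[OF X_def \<kappa>_def a S int MX(1,2,6,5)[OF x] this]
    show ?thesis
      unfolding compactified_components[OF \<rho>(1-3)[OF x] \<sigma> \<kappa>(1) \<kappa>_def MX(5)[OF x] less_imp_neq[OF S]]
      unfolding \<Psi>(2) \<rho>_def[symmetric] unfolding \<Psi>_def compactified_chart_eq .
  qed
  have timelike: "?\<eta> p ^ 2 < ?\<delta> p * ?\<zeta> p" if "p \<in> \<Psi> ` M" for p
  proof -
    have p: "0 < p $ 2" "p $ 2 < 1" "p \<in> U"
      using that \<rho> sub by (auto simp: \<rho>_def)
    \<comment> \<open>Factoring \<open>1 - \<rho>^2 = A * C\<close> and
      \<open>(\<sigma> - \<rho>)^2 = C^2\<close> shows that the second summand of
      \<open>?\<zeta>\<close> times \<open>?\<delta>\<close> is \<open>?\<eta>^2\<close>.\<close>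
    define A C where "A = 1 + \<sigma> * p $ 2" and "C = 1 - \<sigma> * p $ 2"
    have AC: "1 - (p $ 2)^2 = A * C" "(\<sigma> - p $ 2)^2 = C^2" "A \<noteq> 0"
      using \<sigma>2(1) U(2)[OF p(3)] unfolding A_def C_def by (algebra, algebra, simp)
    have "(p $ 2)^2 * (A * C) * (a^2 * C / (\<kappa>^2 * A)) = ?\<eta> p ^ 2"
      using AC(3) \<kappa>(1) by (simp add: power_mult_distrib power_divide AC(2)) (simp add: power2_eq_square)
    then have "?\<delta> p * ?\<zeta> p = (p $ 2)^2 * (1 - (p $ 2)^2) / (sin (p $ 3))^2 + ?\<eta> p ^ 2"
      unfolding A_def[symmetric] C_def[symmetric] AC(1) distrib_left by simp
    moreover have "(p $ 2)^2 < 1"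
      using p by (simp add: power_less_one_iff abs_square_less_1)
    then have "0 < (p $ 2)^2 * (1 - (p $ 2)^2) / (sin (p $ 3))^2"
      using p U[OF p(3)] by simp
    ultimately show ?thesis
      by linarith
  qed
  have bd_zero: "?\<delta> p = 0" "?\<eta> p = 0" if "p \<in> level_set 0" for p
    using bd[OF that] by auto
  note main = null_boundaryI[OF \<open>open U\<close> sub smooth pos_\<Omega> pos det inj cover gt_def q jac timelike bd_zero]
  show ?thesis
    unfolding asymptotically_flat_future_null_infinity_def \<Psi>_def[symmetric]
  proof (intro exI conjI ballI allI impI)
    show "smooth_null_boundary (gt m a S R Rt) (\<lambda>x. (\<Psi> x $ 2)^2) M \<Psi> 0 U
      (\<lambda>p. ?\<Omega> p *\<^sub>R block_inverse (?\<alpha> p) (?\<beta> p) (?\<gamma> p) (?\<delta> p) (?\<eta> p) (?\<zeta> p) 1)"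
      by (rule main(1)) assumption+
    fix p W assume p: "p \<in> level_set 0" and W: "future_timelike
      (\<lambda>p. ?\<Omega> p *\<^sub>R block_inverse (?\<alpha> p) (?\<beta> p) (?\<gamma> p) (?\<delta> p) (?\<eta> p) (?\<zeta> p) 1) p W"
    have "?\<beta> p * W $ 2 < 0"
      by (rule main(2)) (assumption | rule p W)+
    \<comment> \<open>The sign is opposite to that at the horizon: \<rho> decreases to the future,
      so timelike vectors leave.\<close>
    moreover have "0 < ?\<beta> p"
      using U[of p] p sub by auto
    ultimately show "W $ 2 < 0"
      by (metis less_asym mult_less_0_iff)
  qed
qed

theorem proposition3p19:
  fixes m a S R Rt :: real
  assumes "0 < m" and "\<bar>a\<bar> < m" and "S < 0"
  shows
    "(\<forall>x. X_fun S Rt (x $ 2) \<le> - 2 \<and> 0 < x $ 3 \<and> x $ 3 < pi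
        \<longrightarrow> lorentzian (gt m a S R Rt x)) \<and>
     (\<forall>rs w k. outgoing_integrals m a S R Rt {r. Rt - 2 / S < r} rs w k \<longrightarrow>
        smooth_past_horizon (gt m a S R Rt) (region_minus S Rt)
          (outgoing_chart 1 rs w k) (Rt - 2 / S) \<and>
        asymptotically_flat_future_null_infinity (gt m a S R Rt) (region_minus S Rt)
          (compactified_chart S Rt 1 rs w k)) \<and>
     (\<forall>x. X_plus m a (x $ 3) < X_fun S Rt (x $ 2) \<and> 0 < x $ 3 \<and> x $ 3 < pi
        \<longrightarrow> lorentzian (gt m a S R Rt x)) \<and>
     (\<forall>rs w k. outgoing_integrals m a S R Rt
          {r. r < Rt \<and> 0 < Q_fun m a (X_fun S Rt r)} rs w k \<longrightarrow>
        asymptotically_flat_future_null_infinity (gt m a S R Rt) (region_plus m a S Rt)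
          (compactified_chart S Rt (- 1) rs w k))"
proof (intro conjI allI impI; (elim conjE)?)
  fix x :: "real^4" assume x: "X_fun S Rt (x $ 2) \<le> - 2" "0 < x $ 3" "x $ 3 < pi"
  then show "lorentzian (gt m a S R Rt x)"
    using assms P_fun_neg[OF assms(2)] sin_gt_zero[of "x $ 3"] by (intro lorentzian_gt) auto
next
  fix x :: "real^4" assume x: "X_plus m a (x $ 3) < X_fun S Rt (x $ 2)" "0 < x $ 3" "x $ 3 < pi"
  then show "lorentzian (gt m a S R Rt x)"
    using assms P_fun_neg[OF assms(2)] X_plus_nonneg[OF assms(2), of "x $ 3"] sin_gt_zero[of "x $ 3"]
    by (intro lorentzian_gt) auto
next
  fix rs w k assume int: "outgoing_integrals m a S R Rt {r. Rt - 2 / S < r} rs w k"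
  show "smooth_past_horizon (gt m a S R Rt) (region_minus S Rt)
          (outgoing_chart 1 rs w k) (Rt - 2 / S)"
    using assms(2,3) int by (rule smooth_past_horizon_gt)
  have X: "X_fun S Rt r < - 2 \<longleftrightarrow> Rt - 2 / S < r" for r
    using assms(3) by (auto simp: X_fun_def field_simps)
  show "asymptotically_flat_future_null_infinity (gt m a S R Rt) (region_minus S Rt)
          (compactified_chart S Rt 1 rs w k)"
    \<comment> \<open>For \<open>\<sigma> = 1\<close>, \<open>X < - 2\<close> is precisely the range
      \<open>\<rho> < 1\<close>, whence \<open>\<epsilon> = 1\<close>.\<close>
    using assms(2,3) int
    by (rule null_infinity_gt[where \<epsilon> = 1])
      (auto simp: region_minus_def X[symmetric] intro!: P_fun_neg[OF assms(2)] Q_fun_pos[OF assms(2)])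
next
  fix rs w k assume int: "outgoing_integrals m a S R Rt {r. r < Rt \<and> 0 < Q_fun m a (X_fun S Rt r)} rs w k"
  define \<kappa> where "\<kappa> = m^2 - a^2"
  have \<kappa>: "0 < \<kappa>"
    using sq_less_sq[OF assms(2)] by (simp add: \<kappa>_def)
  \<comment> \<open>If \<open>L < X + 1\<close>, the summand 2 gives \<open>X > 1\<close>, the
    second gives \<open>\<kappa> * X^2 > 8 * a^2 * X \<ge> 4 * a^2 * X + 4 * a^2\<close> and so
    \<open>Q_fun > 0\<close>, and the third bounds \<open>X_plus\<close> uniformly in
    \<theta>.\<close>
  define L where "L = 2 + 8 * a^2 / \<kappa> + 2 * \<bar>a\<bar> / (m - \<bar>a\<bar>)"
  have L: "0 < L"
    using \<kappa> assms(2) by (auto simp: L_def intro!: add_pos_nonneg)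
  have far: "X_plus m a \<theta> < X \<and> 0 < Q_fun m a X" if "L < X + 1" for X \<theta>
  proof
    have nn: "0 \<le> 8 * a^2 / \<kappa>" "0 \<le> 2 * \<bar>a\<bar> / (m - \<bar>a\<bar>)"
      using \<kappa> assms(2) by auto
    have "X_plus m a \<theta> \<le> 2 * \<bar>a\<bar> / (m - \<bar>a\<bar>)"
      unfolding X_plus_def using assms(2) by (intro frac_le) (auto simp: abs_mult mult_left_le)
    then show "X_plus m a \<theta> < X"
      using that nn unfolding L_def by linarith
    have X: "1 < X" "8 * a^2 / \<kappa> < X"
      using that nn unfolding L_def by linarith+
    then have "8 * a^2 < \<kappa> * X"
      using \<kappa> by (simp add: field_simps)
    then have "8 * a^2 * X < \<kappa> * X * X"
      using X(1) by simp
    moreover have "4 * a^2 * 1 \<le> 4 * a^2 * X"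
      using X(1) by (intro mult_left_mono) auto
    ultimately show "0 < Q_fun m a X"
      unfolding Q_fun_def \<kappa>_def[symmetric] by (simp add: power2_eq_square)
  qed
  have neg: "r < Rt" if "X_plus m a \<theta> < X_fun S Rt r" for r \<theta>
  proof -
    have "0 < S * (r - Rt)"
      using that X_plus_nonneg[OF assms(2), of \<theta>] by (simp add: X_fun_def)
    then show ?thesis
      using assms(3) by (simp add: zero_less_mult_iff)
  qed
  have pos: "0 < X" if "X_plus m a \<theta> < X" for X \<theta>
    using that X_plus_nonneg[OF assms(2), of \<theta>] by linarith
  show "asymptotically_flat_future_null_infinity (gt m a S R Rt) (region_plus m a S Rt)
          (compactified_chart S Rt (- 1) rs w k)"
    \<comment> \<open>For \<open>\<sigma> = - 1\<close> the condition \<open>\<rho> < 1 / L\<close>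
      is \<open>L < X + 1\<close>, so \<open>far\<close> places a full neighbourhood of infinity in
      the region.\<close>
    using assms(2,3) int
    by (rule null_infinity_gt[where \<epsilon> = "1 / L"])
      (auto simp: region_plus_def L far intro: neg pos P_fun_neg[OF assms(2)])
qed

end
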